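(* Let $\mathbf{r}_1,\ldots,\mathbf{r}_t\in\mathbb{R}^{1\times n}$ be a stream of rows, let $p>0$ be a constant and $W=O(n^p)$ the window size, and let $\mathbf{A}=\mathbf{r}_{t-W+1}\circ\cdots\circ\mathbf{r}_t$ be the matrix consisting of the $W$ most recent rows. Then, given a parameter $\varepsilon>0$, there exists an algorithm in the sliding window model that, with probability at least $\frac23$, outputs a matrix $\mathbf{B}$ with a subset of (rescaled) rows of $\mathbf{A}$ such that \[\|\mathbf{A}^\top\mathbf{A}-\mathbf{B}^\top\mathbf{B}\|_F\le\varepsilon\|\mathbf{A}\|_F^2.\] With high probability, the algorithm uses $O\!\left(\frac{n}{\varepsilon^2}\log n\left(\log\log n+\log\frac{1}{\varepsilon}\right)\right)$ bits of space.
   Context: Sliding window model: rows arrive one at a time in a single pass; at the current time $t$ the relevant data is the matrix of the $W$ most recent rows. $\mathbf{X}\circ\mathbf{Y}$ denotes vertical stacking of rows.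
   Formalization: Nonzero entries are assumed to have magnitude in [1/L, L] with L = O(n^q), q constant; the algorithm outputs the positions and exact scaling factors of the rows of B plus a copy of B rounded entrywise to relative error ε (same error bound), since finitely many bits cannot hold exact real rows. *)

theory Defs
  imports
    "HOL-Probability.Probability"
    "HOL-Library.Landau_Symbols"
    "Jordan_Normal_Form.Matrix"
begin

unbundle no vec_syntax

definition frobenius_norm :: "real mat \<Rightarrow> real" where
  "frobenius_norm A = sqrt (\<Sum>i<dim_row A. \<Sum>j<dim_col A. (A $$ (i, j))\<^sup>2)"

definition covariance_error :: "real mat \<Rightarrow> real mat \<Rightarrow> real" where
  "covariance_error A B =
     frobenius_norm (transpose_mat A * A - transpose_mat B * B)"

text \<open>Rows are listed in order of arrival. Subtraction is truncated, so before time \<open>W\<close> the window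
  holds all rows seen so far.\<close>

definition window :: "nat \<Rightarrow> nat \<Rightarrow> real vec list \<Rightarrow> real mat" where
  "window n W rs = mat_of_rows n (drop (length rs - W) rs)"

text \<open>A single-pass randomized algorithm whose entire memory between two arrivals is a bit string.
  It reads the incoming row exactly, but whatever it wants to remember of it (including
  time stamps and coins) has to be encoded in the bit string. Neither the transition nor
  the output has access to the past rows or to the time. The output consists of a list
  \<open>sel\<close> of pairs (position in the window, scaling factor) and of a matrix.\<close>

record stream_algorithm =
  initial_state :: "bool list pmf"
  process_row :: "bool list \<Rightarrow> real vec \<Rightarrow> bool list pmf"
  answer :: "bool list \<Rightarrow> (nat \<times> real) list \<times> real mat"

text \<open>The distribution of the sequence of all memory states, most recent state first.\<close>

definition run :: "stream_algorithm \<Rightarrow> real vec list \<Rightarrow> bool list list pmf" where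
  "run alg rs =
     foldl (\<lambda>D r. bind_pmf D (\<lambda>h. map_pmf (\<lambda>s. s # h) (process_row alg (hd h) r)))
       (map_pmf (\<lambda>s. [s]) (initial_state alg)) rs"

definition peak_space :: "bool list list \<Rightarrow> nat" where
  "peak_space h = Max (length ` set h)"

definition selects_rows :: "real mat \<Rightarrow> (nat \<times> real) list \<Rightarrow> bool" where
  "selects_rows A sel \<longleftrightarrow>
     distinct (map fst sel) \<and> (\<forall>(i, c) \<in> set sel. i < dim_row A \<and> c > 0)"

definition rescaled_rows :: "real mat \<Rightarrow> (nat \<times> real) list \<Rightarrow> real mat" where
  "rescaled_rows A sel = mat_of_rows (dim_col A) (map (\<lambda>(i, c). c \<cdot>\<^sub>v row A i) sel)"

text \<open>Finitely many bits cannot hold a real row exactly, so the numerical matrix is an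
  entrywise floating-point copy, of relative precision \<open>\<epsilon>\<close>, of the sampled matrix.\<close>

definition rounding_of :: "real \<Rightarrow> real mat \<Rightarrow> real mat \<Rightarrow> bool" where
  "rounding_of \<epsilon> B B' \<longleftrightarrow>
     dim_row B' = dim_row B \<and> dim_col B' = dim_col B \<and>
     (\<forall>i < dim_row B. \<forall>j < dim_col B. \<bar>B' $$ (i, j) - B $$ (i, j)\<bar> \<le> \<epsilon> * \<bar>B $$ (i, j)\<bar>)"

text \<open>The guarantee is required both of the exact matrix of rescaled rows of the window that is
  determined by the reported positions and factors, and of its reported numerical copy.\<close>

definition covariance_approximation ::
    "real \<Rightarrow> real mat \<Rightarrow> (nat \<times> real) list \<times> real mat \<Rightarrow> bool" where
  "covariance_approximation \<epsilon> A out \<longleftrightarrow>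
     (let sel = fst out; B = rescaled_rows A sel; B' = snd out in
        selects_rows A sel \<and>
        covariance_error A B \<le> \<epsilon> * (frobenius_norm A)\<^sup>2 \<and>
        rounding_of \<epsilon> B B' \<and>
        covariance_error A B' \<le> \<epsilon> * (frobenius_norm A)\<^sup>2)"

text \<open>Rows of length \<open>n\<close> whose nonzero entries have magnitude in \<open>[1 / L, L]\<close>.\<close>

definition bounded_stream :: "nat \<Rightarrow> real \<Rightarrow> real vec list \<Rightarrow> bool" where
  "bounded_stream n L rs \<longleftrightarrow>
     (\<forall>r \<in> set rs. r \<in> carrier_vec n \<and>
        (\<forall>j<n. r $ j = 0 \<or> (1 / L \<le> \<bar>r $ j\<bar> \<and> \<bar>r $ j\<bar> \<le> L)))"

end

theory Submission
  imports Defs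
begin

text \<open>Rows are sampled with probability proportional to a weight \<open>m\<close>, an integer within a factor 2 of
  \<open>L\<^sup>2\<close> times the squared norm. The memory holds \<open>O(log n)\<close> checkpoints, as in a smooth
  histogram: at each of them \<open>s = O(1/\<epsilon>\<^sup>2)\<close> reservoirs were started, and a checkpoint is dropped as
  soon as its neighbours are within a factor 2 in total weight. So the oldest checkpoint starts
  at or before the window and its total weight \<open>F\<close> is at most twice that of the window.
  Its samples lying in the window, a sampled row \<open>r\<close> contributing \<open>F / (s m)\<close> times the outer product
  of \<open>r\<close> with itself, give an unbiased estimate of the covariance with variance
  \<open>O(\<parallel>A\<parallel>\<^sup>4/s)\<close>, and Chebyshev's inequality applies. Since \<open>F\<close> and \<open>m\<close> are stored exactly, the
  scaling factors are exact; only the entries of the rows are rounded, to relative precision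
  \<open>\<epsilon>/24\<close>. The number of checkpoints and samples is bounded surely, not just with high probability.\<close>

subsection \<open>Lists of independent random elements\<close>

text \<open>The tests that drop checkpoints read only ages and total weights. These are determined
  by the stream, so the random samples never influence which checkpoints survive. Hence the list of
  creation times (\<open>alive\<close>) is deterministic, the memory is a list of independent
  checkpoints indexed by it, and the answer has the law of \<open>s\<close> independent reservoirs
  started at one known time; no conditioning on survival arises.

  Space is measured by counting states: a finite set of reachable states embeds into bit strings of
  logarithmic length. This is why ages and the clock saturate and why entries are rounded to a
  geometric grid. Between \<open>1 / L\<close> and \<open>L\<close>, with \<open>L\<close>
  polynomial in \<open>n\<close>, there are O(log n / \<open>\<epsilon>\<close>) powers of
  \<open>1 + \<delta>\<close>, so one entry costs O(log log n + log (1 / \<open>\<epsilon>\<close>))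
  bits. The O(log n) bits of the counters of a sample are dominated by the cost of its
  \<open>n\<close> entries, so the only factor log n that remains is the number of
  checkpoints.\<close>

primrec indep_list :: "('a \<Rightarrow> 'b pmf) \<Rightarrow> 'a list \<Rightarrow> 'b list pmf" where
  "indep_list V [] = return_pmf []"
| "indep_list V (x # xs) =
     bind_pmf (V x) (\<lambda>y. map_pmf (\<lambda>ys. y # ys) (indep_list V xs))"

lemma set_indep_list:
  "ys \<in> set_pmf (indep_list V xs) \<longleftrightarrow> list_all2 (\<lambda>x y. y \<in> set_pmf (V x)) xs ys"
  by (induction xs arbitrary: ys) (auto simp: list_all2_Cons1)

lemma finite_set_indep_list:
  assumes "\<And>x. x \<in> set xs \<Longrightarrow> finite (set_pmf (V x))"
  shows "finite (set_pmf (indep_list V xs))"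
  using assms by (induction xs) auto

text \<open>Independent draws may be reordered (\<open>bind_commute_pmf\<close>), so updating every
  entry after all have been drawn equals drawing and updating each entry in turn. This keeps samples
  and checkpoints independent along the stream.\<close>

lemma bind_indep_list:
  "bind_pmf (indep_list V xs) (indep_list U) = indep_list (\<lambda>x. bind_pmf (V x) U) xs"
proof (induction xs)
  case (Cons x xs)
  have "bind_pmf (indep_list V (x # xs)) (indep_list U) =
      bind_pmf (V x) (\<lambda>y. bind_pmf (indep_list V xs) (\<lambda>ys. bind_pmf (U y) (\<lambda>z.
        map_pmf (\<lambda>zs. z # zs) (indep_list U ys))))"
    by (simp add: map_pmf_def bind_assoc_pmf bind_return_pmf)
  also have "\<dots> = bind_pmf (V x) (\<lambda>y. bind_pmf (U y) (\<lambda>z. bind_pmf (indep_list V xs) (\<lambda>ys.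
        map_pmf (\<lambda>zs. z # zs) (indep_list U ys))))"
    by (subst bind_commute_pmf) simp
  also have "\<dots> = indep_list (\<lambda>x. bind_pmf (V x) U) (x # xs)"
    by (simp add: Cons.IH[symmetric] map_pmf_def bind_assoc_pmf)
  finally show ?case .
qed (simp add: bind_return_pmf)

lemma map_indep_list: "map_pmf (map f) (indep_list V xs) = indep_list (\<lambda>x. map_pmf f (V x)) xs"
proof (induction xs)
  case (Cons x xs)
  then show ?case
    by (simp add: map_bind_pmf bind_map_pmf pmf.map_comp o_def flip: Cons.IH)
qed simp

lemma indep_list_map: "indep_list V (map f xs) = indep_list (\<lambda>x. V (f x)) xs"
  by (induction xs) auto

lemma indep_list_cong:
  "(\<And>x. x \<in> set xs \<Longrightarrow> V x = U x) \<Longrightarrow> indep_list V xs = indep_list U xs"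
  by (induction xs) auto

lemma indep_list_return: "indep_list (\<lambda>x. return_pmf (f x)) xs = return_pmf (map f xs)"
  by (induction xs) (auto simp: bind_return_pmf)

lemma indep_list_snoc_return:
  assumes "V x = return_pmf y"
  shows "indep_list V (xs @ [x]) = map_pmf (\<lambda>ys. ys @ [y]) (indep_list V xs)"
  using assms
  by (induction xs) (auto simp: bind_return_pmf map_bind_pmf pmf.map_comp o_def)

lemma map_hd_indep_list: "map_pmf hd (indep_list V (x # xs)) = V x"
  by (simp add: map_bind_pmf pmf.map_comp o_def bind_return_pmf')

section \<open>Mean and variance of sums of independent draws\<close>

lemma expectation_indep_list_Cons:
  fixes F :: "'b list \<Rightarrow> real"
  assumes "finite (set_pmf p)"
  shows "measure_pmf.expectation (indep_list (\<lambda>_. p) (x # xs)) F =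
    measure_pmf.expectation p (\<lambda>y. measure_pmf.expectation (indep_list (\<lambda>_. p) xs) (\<lambda>ys. F (y # ys)))"
  using assms
  by (simp add: pmf_expectation_bind[where A = "set_pmf p"] integral_measure_pmf[where A = "set_pmf p"]
      finite_set_indep_list)

text \<open>The first moment is carried through the induction because it makes the cross term of
  \<open>power2_sum\<close> vanish when the tail of the list is integrated out.\<close>

lemma second_moment_indep_list:
  fixes g :: "'b \<Rightarrow> real"
  assumes fin: "finite (set_pmf p)" and mean: "measure_pmf.expectation p g = 0"
  shows "measure_pmf.expectation (indep_list (\<lambda>_. p) xs) (\<lambda>ys. \<Sum>y\<leftarrow>ys. g y) = 0 \<and>
    measure_pmf.expectation (indep_list (\<lambda>_. p) xs) (\<lambda>ys. (\<Sum>y\<leftarrow>ys. g y)\<^sup>2) =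
      length xs * measure_pmf.expectation p (\<lambda>y. (g y)\<^sup>2)"
proof (induction xs)
  case (Cons x xs)
  have int: "integrable (measure_pmf p) f" for f :: "'b \<Rightarrow> real"
    using fin by (rule integrable_measure_pmf_finite)
  have intl: "integrable (measure_pmf (indep_list (\<lambda>_. p) xs)) f" for f :: "'b list \<Rightarrow> real"
    using fin by (intro integrable_measure_pmf_finite finite_set_indep_list)
  show ?case
    using Cons mean
    by (simp add: expectation_indep_list_Cons[OF fin] power2_sum int intl algebra_simps
        del: indep_list.simps)
qed simp

text \<open>Centring with \<open>length ys\<close>, not \<open>length xs\<close>, lets the mean be
  moved inside the sum for every list \<open>ys\<close>, by induction on \<open>ys\<close>. The
  bound itself is the variance with the squared mean dropped.\<close>

lemma second_moment_deviation:
  fixes f :: "'b \<Rightarrow> real"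
  assumes fin: "finite (set_pmf p)"
  shows "measure_pmf.expectation (indep_list (\<lambda>_. p) xs)
      (\<lambda>ys. ((\<Sum>y\<leftarrow>ys. f y) - length ys * measure_pmf.expectation p f)\<^sup>2) \<le>
    length xs * measure_pmf.expectation p (\<lambda>y. (f y)\<^sup>2)"
proof -
  let ?\<mu> = "measure_pmf.expectation p f"
  have int: "integrable (measure_pmf p) f" for f :: "'b \<Rightarrow> real"
    using fin by (rule integrable_measure_pmf_finite)
  have "(\<Sum>y\<leftarrow>ys. f y) - length ys * ?\<mu> = (\<Sum>y\<leftarrow>ys. f y - ?\<mu>)" for ys
    by (induction ys) (auto simp: algebra_simps)
  moreover have "measure_pmf.expectation p (\<lambda>y. f y - ?\<mu>) = 0"
    by (simp add: int)
  ultimately have "measure_pmf.expectation (indep_list (\<lambda>_. p) xs)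
      (\<lambda>ys. ((\<Sum>y\<leftarrow>ys. f y) - length ys * ?\<mu>)\<^sup>2) =
      length xs * measure_pmf.expectation p (\<lambda>y. (f y - ?\<mu>)\<^sup>2)"
    using second_moment_indep_list[OF fin, of "\<lambda>y. f y - ?\<mu>" xs] by simp
  also have "measure_pmf.expectation p (\<lambda>y. (f y - ?\<mu>)\<^sup>2) =
      measure_pmf.expectation p (\<lambda>y. (f y)\<^sup>2) - ?\<mu>\<^sup>2"
    by (subst measure_pmf.variance_eq[of p f, symmetric]) (auto simp: int)
  finally show ?thesis
    by (simp add: mult_left_mono)
qed

subsection \<open>Storing an abstract state in a bit string\<close>

lemma run_snoc:
  "run alg (rs @ [r]) =
    bind_pmf (run alg rs) (\<lambda>h. map_pmf (\<lambda>s. s # h) (process_row alg (hd h) r))"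
  by (simp add: run_def)

lemma map_hd_run_snoc:
  "map_pmf hd (run alg (rs @ [r])) =
    bind_pmf (map_pmf hd (run alg rs)) (\<lambda>s. process_row alg s r)"
  by (simp add: run_snoc map_bind_pmf bind_map_pmf pmf.map_comp o_def)

lemma peak_space_le:
  assumes init: "\<And>s. s \<in> set_pmf (initial_state alg) \<Longrightarrow> length s \<le> B"
    and step: "\<And>s s' r. s' \<in> set_pmf (process_row alg s r) \<Longrightarrow> length s' \<le> B"
    and h: "h \<in> set_pmf (run alg rs)"
  shows "peak_space h \<le> B"
proof -
  have "h \<noteq> [] \<and> (\<forall>s \<in> set h. length s \<le> B)"
    using h
  proof (induction rs arbitrary: h rule: rev_induct)
    case Nil
    then show ?case using init by (auto simp: run_def)
  next
    case (snoc r rs)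
    then show ?case using step by (fastforce simp: run_snoc)
  qed
  then show ?thesis
    by (auto simp: peak_space_def)
qed

definition abstract_run :: "'s \<Rightarrow> ('s \<Rightarrow> 'r \<Rightarrow> 's pmf) \<Rightarrow> 'r list \<Rightarrow> 's pmf" where
  "abstract_run init step rs = foldl (\<lambda>D r. bind_pmf D (\<lambda>s. step s r)) (return_pmf init) rs"

lemma abstract_run_snoc:
  "abstract_run init step (rs @ [r]) = bind_pmf (abstract_run init step rs) (\<lambda>s. step s r)"
  by (simp add: abstract_run_def)

text \<open>Only the number of abstract states matters for the space: any injection of them into
  bit strings will do. Unforeseen states are mapped to the empty string, so that the space
  bound holds unconditionally.\<close>

lemma bit_string_algorithm:
  fixes step :: "'s \<Rightarrow> real vec \<Rightarrow> 's pmf"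
  assumes fin: "finite S" and card: "card S \<le> 2 ^ B"
  obtains alg where
    "\<And>rs. (\<And>k. k \<le> length rs \<Longrightarrow> set_pmf (abstract_run init step (take k rs)) \<subseteq> S) \<Longrightarrow>
       map_pmf (\<lambda>h. answer alg (hd h)) (run alg rs) = map_pmf out (abstract_run init step rs)"
    and "\<And>rs h. h \<in> set_pmf (run alg rs) \<Longrightarrow> peak_space h \<le> B"
proof -
  let ?T = "{bs :: bool list. set bs \<subseteq> UNIV \<and> length bs = B}"
  have "finite ?T" "card ?T = 2 ^ B"
    by (rule finite_lists_length_eq, simp, subst card_lists_length_eq) auto
  then obtain e where e: "e ` S \<subseteq> ?T" "inj_on e S"
    using card_le_inj[OF fin, of ?T] card by auto
  define enc where "enc s = (if s \<in> S then e s else [])" for s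
  define dec where "dec = inv_into S e"
  have dec: "dec (enc s) = s" if "s \<in> S" for s
    using that e by (simp add: enc_def dec_def)
  have len: "length (enc s) \<le> B" for s
    using e by (auto simp: enc_def)
  define alg where "alg = \<lparr>initial_state = return_pmf (enc init),
    process_row = (\<lambda>b r. map_pmf enc (step (dec b) r)), answer = (\<lambda>b. out (dec b))\<rparr>"
  \<comment> \<open>Only the law of the newest memory state is simulated, since
    \<open>answer\<close> sees nothing else; the history enters through \<open>peak_space\<close>
    alone.\<close>
  have sim: "map_pmf hd (run alg rs) = map_pmf enc (abstract_run init step rs)"
    if "\<And>k. k \<le> length rs \<Longrightarrow> set_pmf (abstract_run init step (take k rs)) \<subseteq> S" for rs
    using that
  proof (induction rs rule: rev_induct)
    case Nil
    then show ?case by (simp add: run_def abstract_run_def alg_def)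
  next
    case (snoc r rs)
    have pre: "set_pmf (abstract_run init step (take k rs)) \<subseteq> S" if "k \<le> length rs" for k
      using snoc.prems[of k] that by simp
    have "map_pmf hd (run alg (rs @ [r])) =
        bind_pmf (abstract_run init step rs) (\<lambda>s. map_pmf enc (step (dec (enc s)) r))"
      by (subst map_hd_run_snoc, subst snoc.IH[OF pre]) (simp_all add: bind_map_pmf alg_def)
    also have "\<dots> = bind_pmf (abstract_run init step rs) (\<lambda>s. map_pmf enc (step s r))"
      by (intro bind_pmf_cong refl) (use pre[of "length rs"] dec in auto)
    finally show ?case
      by (simp add: abstract_run_snoc map_bind_pmf)
  qed
  show thesis
  proof
    fix rs
    assume *: "\<And>k. k \<le> length rs \<Longrightarrow> set_pmf (abstract_run init step (take k rs)) \<subseteq> S"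
    have "map_pmf (\<lambda>h. answer alg (hd h)) (run alg rs) =
        map_pmf (answer alg) (map_pmf hd (run alg rs))"
      by (simp add: pmf.map_comp o_def)
    also have "\<dots> = map_pmf (\<lambda>s. out (dec (enc s))) (abstract_run init step rs)"
      by (subst sim[OF *]) (simp_all add: pmf.map_comp o_def, simp add: alg_def)
    also have "\<dots> = map_pmf out (abstract_run init step rs)"
      by (intro map_pmf_cong refl) (use *[of "length rs"] dec in auto)
    finally show "map_pmf (\<lambda>h. answer alg (hd h)) (run alg rs) =
        map_pmf out (abstract_run init step rs)" .
  next
    fix rs h
    assume "h \<in> set_pmf (run alg rs)"
    then show "peak_space h \<le> B"
      by (rule peak_space_le[rotated 2]) (auto simp: alg_def len)
  qed
qed

subsection \<open>Thinning a list of checkpoints\<close>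

fun thin :: "('a \<Rightarrow> nat) \<Rightarrow> 'a list \<Rightarrow> 'a list" where
  "thin k (x # y # z # zs) =
     (if k x \<le> 2 * k z then thin k (x # z # zs) else x # thin k (y # z # zs))"
| "thin k [] = []"
| "thin k [x] = [x]"
| "thin k [x, y] = [x, y]"

text \<open>The head goes only when its successor is expired too. So the last expired checkpoint
  survives, and a checkpoint covering the whole window stays available.\<close>

fun expire :: "('a \<Rightarrow> bool) \<Rightarrow> 'a list \<Rightarrow> 'a list" where
  "expire e (x # y # zs) = (if e y then expire e (y # zs) else x # y # zs)"
| "expire e [] = []"
| "expire e [x] = [x]"

fun halving :: "('a \<Rightarrow> nat) \<Rightarrow> 'a list \<Rightarrow> bool" where
  "halving k (x # y # z # zs) \<longleftrightarrow> 2 * k z < k x \<and> halving k (y # z # zs)"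
| "halving k [] \<longleftrightarrow> True"
| "halving k [x] \<longleftrightarrow> True"
| "halving k [x, y] \<longleftrightarrow> True"

lemma thin_Cons: "\<exists>ys. thin k (x # xs) = x # ys \<and> set ys \<subseteq> set xs"
  by (induction k "x # xs" arbitrary: x xs rule: thin.induct) fastforce+

lemma set_thin_subset: "set (thin k xs) \<subseteq> set xs"
  using thin_Cons[of k "hd xs" "tl xs"] by (cases xs) auto

lemma last_thin: "last (thin k xs) = last xs"
proof (induction k xs rule: thin.induct)
  case (1 k x y z zs)
  then show ?case using thin_Cons[of k y "z # zs"] by auto
qed auto

lemma sorted_wrt_thin: "sorted_wrt P xs \<Longrightarrow> sorted_wrt P (thin k xs)"
proof (induction k xs rule: thin.induct)
  case (1 k x y z zs)
  then show ?case using set_thin_subset[of k "y # z # zs"] by auto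
qed auto

text \<open>New neighbours arise only when the element between them is dropped, and the test that
  drops it is the second disjunct. \<open>Q\<close> describes neighbours that were adjacent from the
  start.\<close>

lemma successively_thin:
  assumes "successively (\<lambda>x y. Q x y \<or> k x \<le> 2 * k y) xs"
  shows "successively (\<lambda>x y. Q x y \<or> k x \<le> 2 * k y) (thin k xs)"
  using assms
proof (induction k xs rule: thin.induct)
  case (1 k x y z zs)
  then show ?case using thin_Cons[of k y "z # zs"] by (auto simp: successively_Cons)
qed auto

text \<open>Thinning the tail may remove \<open>z\<close>, but the element then two places after
  \<open>x\<close> comes from \<open>z # zs\<close>, so monotone keys carry the failed test
  \<open>k x \<le> 2 * k z\<close> over to it.\<close>

lemma halving_thin: "sorted_wrt (\<lambda>x y. k y \<le> k x) xs \<Longrightarrow> halving k (thin k xs)"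
proof (induction k xs rule: thin.induct)
  case (1 k x y z zs)
  show ?case
  proof (cases "k x \<le> 2 * k z")
    case True
    with 1 show ?thesis by simp
  next
    case False
    obtain ys where ys: "thin k (y # z # zs) = y # ys" "set ys \<subseteq> set (z # zs)"
      using thin_Cons by metis
    have "k u \<le> k z" if "u \<in> set ys" for u
      using that ys(2) 1(3) by auto
    moreover have "halving k (y # ys)"
      using 1(2)[OF False] 1(3) ys by simp
    ultimately have "halving k (x # y # ys)"
      using False by (cases ys) force+
    with False ys show ?thesis by simp
  qed
qed auto

text \<open>Two places further the key has more than halved, which lowers \<open>j\<close> by one.
  At \<open>j = 0\<close> the head has key 0, and a third element would need a key below half of
  that.\<close>

lemma length_halving:
  "halving k xs \<Longrightarrow> xs \<noteq> [] \<Longrightarrow> k (hd xs) < 2 ^ j \<Longrightarrow> length xs \<le> 2 * j + 2"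
proof (induction j arbitrary: xs)
  case 0
  then show ?case by (cases "(k, xs)" rule: halving.cases) auto
next
  case (Suc j)
  show ?case
  proof (cases "(k, xs)" rule: halving.cases)
    case (1 k' x y z zs)
    then have "halving k (z # zs)" using Suc.prems by (cases zs) auto
    then show ?thesis using 1 Suc.prems Suc.IH[of "z # zs"] by auto
  qed auto
qed

lemma expire_suffix: "\<exists>ys. xs = ys @ expire e xs"
proof (induction e xs rule: expire.induct)
  case (1 e x y zs)
  show ?case
  proof (cases "e y")
    case True
    then obtain ys where "y # zs = ys @ expire e (y # zs)" using 1 by metis
    with True have "x # y # zs = (x # ys) @ expire e (x # y # zs)" by simp
    then show ?thesis ..
  qed simp
qed simp_all

lemma expire_eq_Nil_iff: "expire e xs = [] \<longleftrightarrow> xs = []"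
  by (induction e xs rule: expire.induct) auto

lemma hd_expire: "xs \<noteq> [] \<Longrightarrow> e (hd xs) \<Longrightarrow> e (hd (expire e xs))"
  by (induction e xs rule: expire.induct) auto

lemma tl_expire:
  assumes "sorted_wrt (\<lambda>x y. e y \<longrightarrow> e x) xs" "y \<in> set (tl (expire e xs))"
  shows "\<not> e y"
  using assms by (induction e xs rule: expire.induct) (auto split: if_splits)

text \<open>The key of an entry is the same for all outcomes of its draw. So the decision to drop is
  made on the index list, and a dropped entry is simply integrated out.\<close>

lemma map_thin_indep_list:
  assumes "\<And>x y. x \<in> set xs \<Longrightarrow> y \<in> set_pmf (V x) \<Longrightarrow> k' y = k x"
  shows "map_pmf (thin k') (indep_list V xs) = indep_list V (thin k xs)"
  using assms
proof (induction k xs rule: thin.induct)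
  case (1 k x y z zs)
  have key: "k' x' = k x" "k' z' = k z" if "x' \<in> set_pmf (V x)" "z' \<in> set_pmf (V z)" for x' z'
    using 1(3) that by simp_all
  have "map_pmf (thin k') (indep_list V (x # y # z # zs)) =
      bind_pmf (V x) (\<lambda>x'. bind_pmf (V y) (\<lambda>y'. bind_pmf (V z) (\<lambda>z'.
        map_pmf (\<lambda>zs'. thin k' (x' # y' # z' # zs')) (indep_list V zs))))"
    by (simp add: map_bind_pmf pmf.map_comp o_def del: thin.simps)
  also have "\<dots> = bind_pmf (V x) (\<lambda>x'. bind_pmf (V y) (\<lambda>y'. bind_pmf (V z) (\<lambda>z'.
      map_pmf (\<lambda>zs'. if k x \<le> 2 * k z then thin k' (x' # z' # zs') else
        x' # thin k' (y' # z' # zs')) (indep_list V zs))))"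
    by (intro bind_pmf_cong map_pmf_cong refl) (use key in auto)
  also have "\<dots> = indep_list V (thin k (x # y # z # zs))"
  proof (cases "k x \<le> 2 * k z")
    case True
    then have "bind_pmf (V x) (\<lambda>x'. bind_pmf (V y) (\<lambda>y'. bind_pmf (V z) (\<lambda>z'.
      map_pmf (\<lambda>zs'. if k x \<le> 2 * k z then thin k' (x' # z' # zs') else
        x' # thin k' (y' # z' # zs')) (indep_list V zs)))) =
        map_pmf (thin k') (indep_list V (x # z # zs))"
      by (simp add: map_bind_pmf pmf.map_comp o_def del: thin.simps)
    also have "\<dots> = indep_list V (thin k (x # z # zs))"
      using True 1(3) by (intro 1(1)) auto
    finally show ?thesis using True by simp
  next
    case False
    then have "bind_pmf (V x) (\<lambda>x'. bind_pmf (V y) (\<lambda>y'. bind_pmf (V z) (\<lambda>z'.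
      map_pmf (\<lambda>zs'. if k x \<le> 2 * k z then thin k' (x' # z' # zs') else
        x' # thin k' (y' # z' # zs')) (indep_list V zs)))) =
        bind_pmf (V x) (\<lambda>x'. map_pmf (\<lambda>ys. x' # ys) (map_pmf (thin k') (indep_list V (y # z # zs))))"
      by (simp add: map_bind_pmf pmf.map_comp o_def del: thin.simps)
    also have "map_pmf (thin k') (indep_list V (y # z # zs)) = indep_list V (thin k (y # z # zs))"
      using False 1(3) by (intro 1(2)) auto
    finally show ?thesis using False by simp
  qed
  finally show ?case .
qed (auto simp: map_bind_pmf pmf.map_comp o_def)

lemma map_expire_indep_list:
  assumes "\<And>x y. x \<in> set xs \<Longrightarrow> y \<in> set_pmf (V x) \<Longrightarrow> e' y = e x"
  shows "map_pmf (expire e') (indep_list V xs) = indep_list V (expire e xs)"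
  using assms
proof (induction e xs rule: expire.induct)
  case (1 e x y zs)
  have key: "e' y' = e y" if "y' \<in> set_pmf (V y)" for y'
    using 1(2) that by simp
  have "map_pmf (expire e') (indep_list V (x # y # zs)) =
      bind_pmf (V x) (\<lambda>x'. bind_pmf (V y) (\<lambda>y'.
        map_pmf (\<lambda>zs'. expire e' (x' # y' # zs')) (indep_list V zs)))"
    by (simp add: map_bind_pmf pmf.map_comp o_def del: expire.simps)
  also have "\<dots> = bind_pmf (V x) (\<lambda>x'. bind_pmf (V y) (\<lambda>y'.
      map_pmf (\<lambda>zs'. if e y then expire e' (y' # zs') else x' # y' # zs') (indep_list V zs)))"
    by (intro bind_pmf_cong map_pmf_cong refl) (use key in auto)
  also have "\<dots> = indep_list V (expire e (x # y # zs))"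
  proof (cases "e y")
    case True
    then have "bind_pmf (V x) (\<lambda>x'. bind_pmf (V y) (\<lambda>y'.
      map_pmf (\<lambda>zs'. if e y then expire e' (y' # zs') else x' # y' # zs') (indep_list V zs))) =
        map_pmf (expire e') (indep_list V (y # zs))"
      by (simp add: map_bind_pmf pmf.map_comp o_def del: expire.simps)
    also have "\<dots> = indep_list V (expire e (y # zs))"
      using True 1(2) by (intro 1(1)) auto
    finally show ?thesis using True by simp
  next
    case False
    then show ?thesis by (simp add: map_bind_pmf pmf.map_comp o_def)
  qed
  finally show ?case .
qed (auto simp: map_bind_pmf pmf.map_comp o_def)

subsection \<open>The surviving checkpoints\<close>

definition tail_weight :: "(nat \<Rightarrow> nat) \<Rightarrow> nat \<Rightarrow> nat \<Rightarrow> nat" where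
  "tail_weight w a t = sum w {a..<t}"

lemma tail_weight_Suc: "a \<le> t \<Longrightarrow> tail_weight w a (Suc t) = tail_weight w a t + w t"
  by (simp add: tail_weight_def)

lemma tail_weight_antimono: "a \<le> b \<Longrightarrow> tail_weight w b t \<le> tail_weight w a t"
  unfolding tail_weight_def by (intro sum_mono2) auto

text \<open>Creation times of the checkpoints held after \<open>t\<close> rows, a checkpoint created
  at \<open>a\<close> covering the rows \<open>{a..<t}\<close>. The condition
  \<open>a + W \<le> Suc t\<close> says that \<open>a\<close> is at or before the first row of the
  window.\<close>

primrec alive :: "nat \<Rightarrow> (nat \<Rightarrow> nat) \<Rightarrow> nat \<Rightarrow> nat list" where
  "alive W w 0 = []"
| "alive W w (Suc t) = thin (\<lambda>a. tail_weight w a (Suc t))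
     (expire (\<lambda>a. a + W \<le> Suc t) (alive W w t @ [t]))"

lemma alive_less: "a \<in> set (alive W w t) \<Longrightarrow> a < t"
proof (induction t arbitrary: a)
  case (Suc t)
  obtain ys where "alive W w t @ [t] = ys @ expire (\<lambda>a. a + W \<le> Suc t) (alive W w t @ [t])"
    using expire_suffix by metis
  then have "set (expire (\<lambda>a. a + W \<le> Suc t) (alive W w t @ [t])) \<subseteq> set (alive W w t @ [t])"
    by (metis set_append sup_ge2)
  then have "a \<in> set (alive W w t @ [t])"
    using Suc.prems set_thin_subset[of "\<lambda>a. tail_weight w a (Suc t)"] by fastforce
  then show ?case using Suc.IH by force
qed simp

definition linked :: "(nat \<Rightarrow> nat) \<Rightarrow> nat \<Rightarrow> nat \<Rightarrow> nat \<Rightarrow> bool" where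
  "linked w t a b \<longleftrightarrow> b = Suc a \<or> tail_weight w a t \<le> 2 * tail_weight w b t"

text \<open>A new row adds the same weight to both tails, which preserves a comparison up to the
  factor 2. This is the smoothness behind the histogram.\<close>

lemma linked_Suc: "linked w t a b \<Longrightarrow> a < t \<Longrightarrow> b < t \<Longrightarrow> linked w (Suc t) a b"
  by (auto simp: linked_def tail_weight_Suc)

text \<open>The window starts between the first two checkpoints. If it does not start exactly at the
  first one, rows between the two have been thinned out, so \<^const>\<open>linked\<close> compares the weight of
  the first checkpoint with that of the second one.\<close>

lemma alive_invariant:
  assumes "W > 0"
  shows "sorted_wrt (<) (alive W w t) \<and> successively (linked w t) (alive W w t) \<and>
    (t > 0 \<longrightarrow> alive W w t \<noteq> [] \<and> last (alive W w t) = t - 1 \<and>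
      hd (alive W w t) \<le> t - W \<and> (\<forall>b \<in> set (tl (alive W w t)). t < b + W) \<and>
      halving (\<lambda>a. tail_weight w a t) (alive W w t))"
proof (induction t)
  case (Suc t)
  define xs where "xs = alive W w t @ [t]"
  define e where "e = (\<lambda>a. a + W \<le> Suc t)"
  define k where "k = (\<lambda>a. tail_weight w a (Suc t))"
  define ys where "ys = expire e xs"
  have alive: "alive W w (Suc t) = thin k ys"
    by (simp add: xs_def e_def k_def ys_def)
  have sorted: "sorted_wrt (<) xs"
    using Suc alive_less by (auto simp: xs_def sorted_wrt_append)
  have succ: "successively (linked w (Suc t)) xs"
  proof -
    have "successively (linked w (Suc t)) (alive W w t)"
      by (rule successively_mono[of "linked w t"]) (use Suc alive_less linked_Suc in auto)
    \<comment> \<open>The newest old checkpoint is \<open>t - 1\<close>, so the first disjunct of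
      \<open>linked\<close> holds.\<close>
    moreover have "linked w (Suc t) (last (alive W w t)) t" if "alive W w t \<noteq> []"
      using that Suc by (cases t) (auto simp: linked_def)
    ultimately show ?thesis
      by (auto simp: xs_def successively_append_iff)
  qed
  obtain zs where zs: "xs = zs @ ys"
    using expire_suffix unfolding ys_def by metis
  have "ys \<noteq> []"
    using expire_eq_Nil_iff[of e xs] by (simp add: ys_def xs_def)
  moreover from this have "last ys = t"
    using arg_cong[OF zs, of last] by (simp add: xs_def)
  ultimately have ys: "sorted_wrt (<) ys" "successively (linked w (Suc t)) ys" "ys \<noteq> []" "last ys = t"
    using sorted succ unfolding zs by (simp_all add: sorted_wrt_append successively_append_iff)
  have hd_xs: "hd xs \<le> Suc t - W"
  proof (cases "t = 0")
    case True
    then show ?thesis by (simp add: xs_def)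
  next
    case False
    then have "alive W w t \<noteq> []" "hd (alive W w t) \<le> t - W"
      using Suc.IH by simp_all
    then show ?thesis by (simp add: xs_def)
  qed
  have hd: "hd ys \<le> Suc t - W"
  proof (cases "W \<le> Suc t")
    case True
    then have "e (hd xs)" using hd_xs by (simp add: e_def)
    then have "e (hd ys)"
      using hd_expire[of xs e] unfolding ys_def by (simp add: xs_def)
    then show ?thesis by (simp add: e_def)
  next
    case False
    \<comment> \<open>Before the window is full, \<open>e\<close> holds nowhere and nothing is
      dropped.\<close>
    then have "ys = xs"
      unfolding ys_def by (cases "(e, xs)" rule: expire.cases) (auto simp: e_def)
    then show ?thesis using hd_xs by simp
  qed
  have "sorted_wrt (\<lambda>x y. e y \<longrightarrow> e x) xs"
    by (rule sorted_wrt_mono_rel[OF _ sorted]) (auto simp: e_def)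
  then have tl: "\<not> e b" if "b \<in> set (tl ys)" for b
    using tl_expire that unfolding ys_def by metis
  obtain us where us: "thin k ys = hd ys # us" "set us \<subseteq> set (tl ys)"
    using thin_Cons[of k "hd ys" "tl ys"] ys(3) by auto
  have "sorted_wrt (\<lambda>x y. k y \<le> k x) ys"
    by (rule sorted_wrt_mono_rel[OF _ ys(1)]) (auto simp: k_def tail_weight_antimono)
  then have "halving k (thin k ys)"
    by (rule halving_thin)
  moreover have "sorted_wrt (<) (thin k ys)"
    using ys by (intro sorted_wrt_thin)
  moreover have "successively (linked w (Suc t)) (thin k ys)"
    using successively_thin[of "\<lambda>x y. y = Suc x" k ys] ys(2)
    unfolding linked_def k_def by simp
  moreover have "last (thin k ys) = t"
    by (simp add: last_thin ys)
  moreover have "Suc t < b + W" if "b \<in> set us" for b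
    using tl[of b] that us(2) by (auto simp: e_def)
  ultimately show ?case
    unfolding alive using us hd by (simp add: k_def)
qed simp

text \<open>If the head \<open>a\<close> lies before the window, it is not the last checkpoint
  \<open>t - 1\<close>, so it has a successor \<open>b\<close>. That successor lies strictly after
  the first row of the window, hence \<open>b > Suc a\<close>, and \<open>linked\<close> can only
  hold through the weights.\<close>

lemma alive_head:
  assumes "W > 0" "t > 0"
  obtains a as where "alive W w t = a # as" "a \<le> t - W" "a < t"
    "tail_weight w a t \<le> 2 * tail_weight w (t - W) t"
proof -
  note inv = alive_invariant[OF \<open>W > 0\<close>, of w t]
  obtain a as where as: "alive W w t = a # as"
    using inv \<open>t > 0\<close> by (cases "alive W w t") auto
  have "tail_weight w a t \<le> 2 * tail_weight w (t - W) t"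
  proof (cases "a = t - W")
    case False
    with inv as assms have lt: "a < t - W" by auto
    with inv as assms obtain b bs where bs: "as = b # bs" by (cases as) auto
    with inv as assms have "t < b + W" "linked w t a b" by auto
    with lt have "tail_weight w a t \<le> 2 * tail_weight w b t"
      by (auto simp: linked_def)
    also have "tail_weight w b t \<le> tail_weight w (t - W) t"
      using \<open>t < b + W\<close> by (intro tail_weight_antimono) auto
    finally show ?thesis by simp
  qed simp
  moreover have "a < t" using alive_less[of a W w t] as by simp
  ultimately show thesis using that as inv \<open>t > 0\<close> by auto
qed

lemma alive_tail_weight_le:
  assumes "W > 0" "a \<in> set (alive W w t)"
  shows "tail_weight w a t \<le> 2 * tail_weight w (t - W) t"
proof -
  have "t > 0" using alive_less[OF assms(2)] by simp
  then obtain b bs where b: "alive W w t = b # bs" "tail_weight w b t \<le> 2 * tail_weight w (t - W) t"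
    using alive_head[OF assms(1)] by metis
  have "b \<le> a"
    using alive_invariant[OF assms(1), of w t] assms(2) b(1) by auto
  then have "tail_weight w a t \<le> tail_weight w b t"
    by (rule tail_weight_antimono)
  with b show ?thesis by simp
qed

lemma length_alive_le:
  assumes "W > 0" "2 * tail_weight w (t - W) t < 2 ^ j"
  shows "length (alive W w t) \<le> 2 * j + 2"
proof (cases "t > 0")
  case True
  then obtain a as where "alive W w t = a # as" "tail_weight w a t \<le> 2 * tail_weight w (t - W) t"
    using alive_head[OF assms(1)] by metis
  then show ?thesis
    using alive_invariant[OF assms(1), of w t] True assms(2)
    by (intro length_halving[of "\<lambda>a. tail_weight w a t"]) auto
qed simp

subsection \<open>Reservoir sampling\<close>

text \<open>The weighted reservoir with one slot: row \<open>t\<close> takes it over with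
  probability equal to its share of the total. While all weights vanish the share is
  \<open>0 / 0 = 0\<close> and \<open>a\<close> is kept; the answer later discards samples of weight
  0.\<close>

primrec reservoir :: "(nat \<Rightarrow> nat) \<Rightarrow> nat \<Rightarrow> nat \<Rightarrow> nat pmf" where
  "reservoir w a 0 = return_pmf a"
| "reservoir w a (Suc t) = (if t \<le> a then return_pmf a else
     bind_pmf (reservoir w a t) (\<lambda>i. map_pmf (\<lambda>b. if b then t else i)
       (bernoulli_pmf (w t / tail_weight w a (Suc t)))))"

lemma set_reservoir: "a < t \<Longrightarrow> set_pmf (reservoir w a t) \<subseteq> {a..<t}"
proof (induction t)
  case (Suc t)
  show ?case
  proof (cases "t \<le> a")
    case True
    with Suc.prems show ?thesis by simp
  next
    case False
    with Suc.IH have "set_pmf (reservoir w a t) \<subseteq> {a..<t}" by simp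
    with False show ?thesis by (auto split: if_splits)
  qed
qed simp

lemma finite_set_reservoir: "a < t \<Longrightarrow> finite (set_pmf (reservoir w a t))"
  by (rule finite_subset[OF set_reservoir]) simp_all

text \<open>Row \<open>i\<close> is held with probability \<open>w i\<close> over the total.
  Multiplying by the total makes the identity meaningful when all weights vanish.\<close>

lemma expectation_reservoir:
  fixes \<phi> :: "nat \<Rightarrow> real"
  assumes "a < t"
  shows "tail_weight w a t * measure_pmf.expectation (reservoir w a t) \<phi> =
    (\<Sum>i=a..<t. w i * \<phi> i)"
  using assms
proof (induction t)
  case (Suc t)
  show ?case
  proof (cases "t \<le> a")
    case True
    with Suc.prems have "t = a" by simp
    then show ?thesis by (simp add: tail_weight_def)
  next
    case False
    let ?T = "real (tail_weight w a (Suc t))" and ?q = "w t / tail_weight w a (Suc t)"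
    let ?E = "measure_pmf.expectation (reservoir w a t) \<phi>"
    have Suc_t: "?T = tail_weight w a t + w t"
      using False by (simp add: tail_weight_Suc)
    then have q: "?q \<in> {0..1}" and qT: "?T * ?q = w t"
      by (auto simp: divide_le_eq_1)
    have int: "integrable (measure_pmf (reservoir w a t)) f" for f :: "nat \<Rightarrow> real"
      using False by (intro integrable_measure_pmf_finite finite_set_reservoir) auto
    have "measure_pmf.expectation (reservoir w a (Suc t)) \<phi> =
        measure_pmf.expectation (reservoir w a t) (\<lambda>i. ?q * \<phi> t + (1 - ?q) * \<phi> i)"
      using False q finite_set_reservoir[of a t w]
      by (simp add: pmf_expectation_bind[where A = "set_pmf (reservoir w a t)"]
          integral_measure_pmf[where A = "set_pmf (reservoir w a t)"] mult.commute)
    also have "\<dots> = ?q * \<phi> t + (1 - ?q) * ?E"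
      by (simp add: int)
    finally have step: "measure_pmf.expectation (reservoir w a (Suc t)) \<phi> =
        ?q * \<phi> t + (1 - ?q) * ?E" .
    \<comment> \<open>Grouped so that \<open>?T * ?q\<close> appears as a term: it equals
      \<open>w t\<close> even when \<open>?T = 0\<close>.\<close>
    have "T * (q * x + (1 - q) * y) = T * q * x + (T - T * q) * y" for T q x y :: real
      by (simp add: algebra_simps)
    then have "?T * measure_pmf.expectation (reservoir w a (Suc t)) \<phi> =
        ?T * ?q * \<phi> t + (?T - ?T * ?q) * ?E"
      unfolding step .
    also have "\<dots> = w t * \<phi> t + tail_weight w a t * ?E"
      unfolding qT by (simp add: Suc_t)
    also have "\<dots> = (\<Sum>i=a..<Suc t. w i * \<phi> i)"
      using False Suc.IH by simp
    finally show ?thesis .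
  qed
qed simp

subsection \<open>The memory of the algorithm\<close>

text \<open>A sample \<open>(g, m, x)\<close> is a row of age \<open>g\<close> (the most recent row has age 1; ages saturate just
  above \<open>W\<close>), weight \<open>m\<close> and stored code \<open>x\<close>. A checkpoint \<open>(g, f, us)\<close> of age \<open>g\<close> has seen rows of
  total weight \<open>f\<close> since its creation and has drawn the samples \<open>us\<close> from them. The memory
  consists of the clock, saturating at \<open>W\<close>, and the list of checkpoints, oldest first.\<close>

type_synonym 'c sample = "nat \<times> nat \<times> 'c"
type_synonym 'c checkpoint = "nat \<times> nat \<times> 'c sample list"
type_synonym 'c memory = "nat \<times> 'c checkpoint list"

locale window_sampler =
  fixes W s :: nat and weight :: "'r \<Rightarrow> nat" and code :: "'r \<Rightarrow> 'c"
begin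

definition new_sample :: "'r \<Rightarrow> 'c sample" where
  "new_sample r = (1, weight r, code r)"

fun age_sample :: "'c sample \<Rightarrow> 'c sample" where
  "age_sample (g, m, x) = (min (Suc W) (Suc g), m, x)"

definition sample_step :: "nat \<Rightarrow> 'r \<Rightarrow> 'c sample \<Rightarrow> 'c sample pmf" where
  "sample_step f r u = map_pmf (\<lambda>b. if b then new_sample r else age_sample u)
     (bernoulli_pmf (weight r / f))"

fun checkpoint_step :: "'r \<Rightarrow> 'c checkpoint \<Rightarrow> 'c checkpoint pmf" where
  "checkpoint_step r (g, f, us) =
     map_pmf (\<lambda>us. (min (Suc W) (Suc g), f + weight r, us))
       (indep_list (sample_step (f + weight r) r) us)"

definition new_checkpoint :: "'r \<Rightarrow> 'c checkpoint" where
  "new_checkpoint r = (1, weight r, replicate s (new_sample r))"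

text \<open>A checkpoint of age exactly \<open>W\<close> starts with the window, so it already
  covers the window and makes older ones redundant. Saturation at \<open>Suc W\<close> does not
  affect the test.\<close>

definition prune :: "'c checkpoint list \<Rightarrow> 'c checkpoint list" where
  "prune cs = thin (\<lambda>(g, f, us). f) (expire (\<lambda>(g, f, us). W \<le> g) cs)"

fun memory_step :: "'c memory \<Rightarrow> 'r \<Rightarrow> 'c memory pmf" where
  "memory_step (\<tau>, cs) r = map_pmf (\<lambda>cs. (min W (Suc \<tau>), prune (cs @ [new_checkpoint r])))
     (indep_list (checkpoint_step r) cs)"

context
  fixes rs :: "'r list"
begin

definition w :: "nat \<Rightarrow> nat" where
  "w i = weight (rs ! i)"

text \<open>The analysis draws row indices; the views translate them into what the memory holds at
  time \<open>t\<close>, where neither indices nor absolute times are available.\<close>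

definition sample_view :: "nat \<Rightarrow> nat \<Rightarrow> 'c sample" where
  "sample_view t i = (min (Suc W) (t - i), w i, code (rs ! i))"

definition checkpoint_view :: "nat \<Rightarrow> nat \<Rightarrow> nat list \<Rightarrow> 'c checkpoint" where
  "checkpoint_view t a is = (min (Suc W) (t - a), tail_weight w a t, map (sample_view t) is)"

definition checkpoint_law :: "nat \<Rightarrow> nat \<Rightarrow> 'c checkpoint pmf" where
  "checkpoint_law t a = map_pmf (checkpoint_view t a) (indep_list (\<lambda>_. reservoir w a t) [0..<s])"

lemma sample_step_view:
  assumes "i < t"
  shows "sample_step f (rs ! t) (sample_view t i) =
    map_pmf (\<lambda>b. sample_view (Suc t) (if b then t else i)) (bernoulli_pmf (w t / f))"
  using assms unfolding sample_step_def sample_view_def new_sample_def w_def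
  by (intro map_pmf_cong) (auto simp: Suc_diff_le)

text \<open>Ageing or replacing a stored sample is the view of a reservoir step on its index. The
  checkpoint step thus acts coordinatewise on independent indices, and
  \<open>bind_indep_list\<close> merges it with the earlier draws.\<close>

lemma checkpoint_law_Suc:
  assumes "a < t"
  shows "bind_pmf (checkpoint_law t a) (checkpoint_step (rs ! t)) = checkpoint_law (Suc t) a"
proof -
  define f where "f = tail_weight w a (Suc t)"
  define K where "K = (\<lambda>i. map_pmf (\<lambda>b. if b then t else i) (bernoulli_pmf (w t / f)))"
  have f: "tail_weight w a t + weight (rs ! t) = f"
    using assms by (simp add: f_def tail_weight_Suc w_def)
  have age: "min (Suc W) (Suc (min (Suc W) (t - a))) = min (Suc W) (Suc t - a)"
    using assms by (auto simp: Suc_diff_le)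
  have step: "checkpoint_step (rs ! t) (checkpoint_view t a is) =
      map_pmf (checkpoint_view (Suc t) a) (indep_list K is)"
    if "is \<in> set_pmf (indep_list (\<lambda>_. reservoir w a t) [0..<s])" for "is"
  proof -
    have lt: "i < t" if "i \<in> set is" for i
      using that \<open>is \<in> _\<close> set_reservoir[OF assms, of w]
      by (fastforce simp: set_indep_list list_all2_conv_all_nth in_set_conv_nth)
    have "indep_list (\<lambda>i. sample_step f (rs ! t) (sample_view t i)) is =
        indep_list (\<lambda>i. map_pmf (sample_view (Suc t)) (K i)) is"
      by (rule indep_list_cong) (simp add: sample_step_view lt K_def pmf.map_comp o_def)
    moreover have "checkpoint_view (Suc t) a =
        (\<lambda>us. (min (Suc W) (Suc (min (Suc W) (t - a))), f, us)) \<circ> map (sample_view (Suc t))"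
      by (rule ext) (simp only: checkpoint_view_def f_def age o_def)
    ultimately show ?thesis
      by (simp add: checkpoint_view_def[of t] f indep_list_map map_indep_list[symmetric]
          pmf.map_comp)
  qed
  have "bind_pmf (checkpoint_law t a) (checkpoint_step (rs ! t)) =
      bind_pmf (indep_list (\<lambda>_. reservoir w a t) [0..<s])
        (\<lambda>is. map_pmf (checkpoint_view (Suc t) a) (indep_list K is))"
    unfolding checkpoint_law_def bind_map_pmf
    by (intro bind_pmf_cong refl) (rule step)
  also have "\<dots> = map_pmf (checkpoint_view (Suc t) a)
      (indep_list (\<lambda>_. bind_pmf (reservoir w a t) K) [0..<s])"
    by (simp add: map_bind_pmf[symmetric] bind_indep_list)
  also have "bind_pmf (reservoir w a t) K = reservoir w a (Suc t)"
    using assms by (simp add: K_def f_def)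
  finally show ?thesis
    by (simp only: checkpoint_law_def)
qed

lemma checkpoint_law_new: "checkpoint_law (Suc t) t = return_pmf (new_checkpoint (rs ! t))"
  by (simp add: checkpoint_law_def indep_list_return checkpoint_view_def new_checkpoint_def
      sample_view_def new_sample_def tail_weight_def w_def map_replicate_const)

text \<open>The link between the memory and the combinatorics of \<open>alive\<close>: every age and
  total tested by \<open>prune\<close> is a function of the creation time, so pruning commutes with
  the random draws.\<close>

lemma memory_law:
  assumes "W > 0" "t \<le> length rs"
  shows "abstract_run (0, []) memory_step (take t rs) =
    map_pmf (Pair (min W t)) (indep_list (checkpoint_law t) (alive W w t))"
  using assms(2)
proof (induction t)
  case 0
  then show ?case by (simp add: abstract_run_def)
next
  case (Suc t)
  let ?k = "\<lambda>(g, f, us). f" and ?e = "\<lambda>(g, f, us). W \<le> g"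
  have ws: "abstract_run (0, []) memory_step (take (Suc t) rs) =
      bind_pmf (indep_list (checkpoint_law t) (alive W w t))
        (\<lambda>cs. memory_step (min W t, cs) (rs ! t))"
    using Suc by (simp add: take_Suc_conv_app_nth abstract_run_snoc bind_map_pmf)
  also have "\<dots> = map_pmf (\<lambda>cs. (min W (Suc t), prune (cs @ [new_checkpoint (rs ! t)])))
      (indep_list (\<lambda>a. bind_pmf (checkpoint_law t a) (checkpoint_step (rs ! t))) (alive W w t))"
    by (simp add: bind_indep_list[symmetric] map_bind_pmf min_def)
  also have "\<dots> = map_pmf (\<lambda>cs. (min W (Suc t), prune (cs @ [new_checkpoint (rs ! t)])))
      (indep_list (checkpoint_law (Suc t)) (alive W w t))"
    by (intro arg_cong2[of _ _ _ _ map_pmf] indep_list_cong refl)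
      (auto dest: alive_less intro: checkpoint_law_Suc)
  also have "\<dots> = map_pmf (Pair (min W (Suc t))) (map_pmf (thin ?k) (map_pmf (expire ?e)
      (indep_list (checkpoint_law (Suc t)) (alive W w t @ [t]))))"
    by (simp add: indep_list_snoc_return[of "checkpoint_law (Suc t)" t, OF checkpoint_law_new] pmf.map_comp o_def prune_def)
  also have "map_pmf (expire ?e) (indep_list (checkpoint_law (Suc t)) (alive W w t @ [t])) =
      indep_list (checkpoint_law (Suc t)) (expire (\<lambda>a. a + W \<le> Suc t) (alive W w t @ [t]))"
  proof (rule map_expire_indep_list)
    fix a c
    assume "a \<in> set (alive W w t @ [t])" and c: "c \<in> set_pmf (checkpoint_law (Suc t) a)"
    then have "a \<le> t" using alive_less[of a W w t] by auto
    with c show "?e c = (a + W \<le> Suc t)"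
      by (auto simp: checkpoint_law_def checkpoint_view_def)
  qed
  also have "map_pmf (thin ?k) \<dots> = indep_list (checkpoint_law (Suc t)) (alive W w (Suc t))"
    unfolding alive.simps
    by (rule map_thin_indep_list) (auto simp: checkpoint_law_def checkpoint_view_def)
  finally show ?case .
qed

end

end

subsection \<open>Gram matrices\<close>

text \<open>The rank-one matrix v v^T as a function on index pairs. In this form Frobenius norms are
  \<open>L2_set\<close> values and inherit its triangle inequality.\<close>

definition outer :: "real vec \<Rightarrow> nat \<times> nat \<Rightarrow> real" where
  "outer v = (\<lambda>(x, y). v $ x * v $ y)"

definition square_norm :: "nat \<Rightarrow> real vec \<Rightarrow> real" where
  "square_norm n v = (\<Sum>j<n. (v $ j)\<^sup>2)"

lemma square_norm_nonneg: "0 \<le> square_norm n v"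
  by (simp add: square_norm_def sum_nonneg)

lemma sum_outer_square: "(\<Sum>p \<in> {..<n} \<times> {..<n}. (outer v p)\<^sup>2) = (square_norm n v)\<^sup>2"
  by (simp add: outer_def square_norm_def power2_eq_square sum_product sum.cartesian_product
      case_prod_beta ac_simps)

lemma L2_set_outer: "L2_set (outer v) ({..<n} \<times> {..<n}) = square_norm n v"
  by (simp add: L2_set_def sum_outer_square square_norm_nonneg)

lemma L2_set_sum_le:
  assumes "finite J"
  shows "L2_set (\<lambda>p. \<Sum>i\<in>J. f i p) I \<le> (\<Sum>i\<in>J. L2_set (f i) I)"
  using assms
proof (induction J rule: finite_induct)
  case (insert j J)
  then show ?case
    using L2_set_triangle_ineq[of "f j" "\<lambda>p. \<Sum>i\<in>J. f i p" I] by simp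
qed (simp add: L2_set_def)

lemma frobenius_norm_eq_L2_set:
  "frobenius_norm M = L2_set (\<lambda>p. M $$ p) ({..<dim_row M} \<times> {..<dim_col M})"
  by (simp add: frobenius_norm_def L2_set_def sum.cartesian_product)

lemma gram_mat_of_rows:
  assumes "x < n" "y < n"
  shows "(transpose_mat (mat_of_rows n vs) * mat_of_rows n vs) $$ (x, y) = (\<Sum>v\<leftarrow>vs. outer v (x, y))"
  using assms
  by (simp add: scalar_prod_def mat_of_rows_def outer_def sum_list_sum_nth atLeast0LessThan)

lemma covariance_error_mat_of_rows:
  "covariance_error (mat_of_rows n us) (mat_of_rows n vs) =
    L2_set (\<lambda>p. (\<Sum>u\<leftarrow>us. outer u p) - (\<Sum>v\<leftarrow>vs. outer v p)) ({..<n} \<times> {..<n})"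
  unfolding covariance_error_def frobenius_norm_eq_L2_set
  by (intro L2_set_cong) (auto simp: gram_mat_of_rows simp del: index_mult_mat(1))

lemma frobenius_norm_mat_of_rows:
  "(frobenius_norm (mat_of_rows n vs))\<^sup>2 = (\<Sum>v\<leftarrow>vs. square_norm n v)"
  by (simp add: frobenius_norm_def square_norm_def sum_nonneg sum_list_sum_nth atLeast0LessThan
      mat_of_rows_def)

lemma outer_smult:
  assumes "v \<in> carrier_vec n" "p \<in> {..<n} \<times> {..<n}"
  shows "outer (c \<cdot>\<^sub>v v) p = c\<^sup>2 * outer v p"
  using assms by (auto simp: outer_def power2_eq_square)

text \<open>Two error terms are linear in \<open>\<delta>\<close> and one is quadratic;
  \<open>\<delta> \<le> 1\<close> makes the quadratic one linear, which gives the factor 3.\<close>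

lemma outer_rounding:
  assumes close: "\<And>j. j < n \<Longrightarrow> \<bar>v' $ j - v $ j\<bar> \<le> \<delta> * \<bar>v $ j\<bar>"
    and \<delta>: "0 \<le> \<delta>" "\<delta> \<le> 1" and p: "p \<in> {..<n} \<times> {..<n}"
  shows "\<bar>outer v p - outer v' p\<bar> \<le> 3 * \<delta> * \<bar>outer v p\<bar>"
proof -
  obtain x y where xy: "p = (x, y)" "x < n" "y < n" using p by auto
  define dx dy where "dx = v' $ x - v $ x" and "dy = v' $ y - v $ y"
  have d: "\<bar>dx\<bar> \<le> \<delta> * \<bar>v $ x\<bar>" "\<bar>dy\<bar> \<le> \<delta> * \<bar>v $ y\<bar>"
    using close xy by (auto simp: dx_def dy_def)
  have "outer v p - outer v' p = - (v $ x * dy + dx * v $ y + dx * dy)"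
    by (simp add: outer_def xy dx_def dy_def algebra_simps)
  then have "\<bar>outer v p - outer v' p\<bar> \<le> \<bar>v $ x\<bar> * \<bar>dy\<bar> + \<bar>dx\<bar> * \<bar>v $ y\<bar> + \<bar>dx\<bar> * \<bar>dy\<bar>"
    by (simp flip: abs_mult)
  also have "\<dots> \<le> \<bar>v $ x\<bar> * (\<delta> * \<bar>v $ y\<bar>) + (\<delta> * \<bar>v $ x\<bar>) * \<bar>v $ y\<bar>
      + (\<delta> * \<bar>v $ x\<bar>) * (1 * \<bar>v $ y\<bar>)"
    using d \<delta> by (intro add_mono mult_mono order_trans[OF d(2)]) auto
  also have "\<dots> = 3 * \<delta> * \<bar>outer v p\<bar>"
    by (simp add: outer_def xy abs_mult algebra_simps)
  finally show ?thesis .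
qed

text \<open>The triangle inequality over the rows, since a rank-one term has Frobenius norm
  \<open>square_norm\<close>. This makes the empty answer valid for
  \<open>\<epsilon> \<ge> 1\<close>.\<close>

lemma covariance_error_empty_le:
  "covariance_error (mat_of_rows n us) (mat_of_rows n []) \<le> (frobenius_norm (mat_of_rows n us))\<^sup>2"
proof -
  have "L2_set (\<lambda>p. \<Sum>u\<leftarrow>us. outer u p) ({..<n} \<times> {..<n}) \<le> (\<Sum>u\<leftarrow>us. square_norm n u)"
  proof (induction us)
    case (Cons u us)
    then show ?case
      using L2_set_triangle_ineq[of "outer u" "\<lambda>p. \<Sum>u\<leftarrow>us. outer u p" "{..<n} \<times> {..<n}"]
      by (simp add: L2_set_outer)
  qed (simp add: L2_set_def)
  then show ?thesis
    by (simp add: covariance_error_mat_of_rows frobenius_norm_mat_of_rows)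
qed

text \<open>Markov's inequality including \<open>c = 0\<close>, which occurs when all rows of the
  window vanish: then \<open>X\<close> has expectation 0 and is zero on the support.\<close>

lemma markov_pmf:
  fixes X :: "'a \<Rightarrow> real"
  assumes fin: "finite (set_pmf p)" and X: "\<And>x. 0 \<le> X x" and c: "0 \<le> c" and \<theta>: "0 \<le> \<theta>"
    and E: "measure_pmf.expectation p X \<le> \<theta> * c"
  shows "measure_pmf.prob p {x. X x \<le> c} \<ge> 1 - \<theta>"
proof (cases "c = 0")
  case True
  have "measure_pmf.expectation p X = (\<Sum>x\<in>set_pmf p. pmf p x * X x)"
    by (subst integral_measure_pmf[OF fin]) (auto simp: set_pmf_iff)
  then have "(\<Sum>x\<in>set_pmf p. pmf p x * X x) = 0"
    using E True X by (intro antisym sum_nonneg) auto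
  then have "pmf p x * X x = 0" if "x \<in> set_pmf p" for x
    using fin X that by (subst (asm) sum_nonneg_eq_0_iff) auto
  then have "AE x in measure_pmf p. x \<in> {x. X x \<le> c}"
    using True by (force simp: AE_measure_pmf_iff set_pmf_iff)
  then have "measure_pmf.prob p {x. X x \<le> c} = 1"
    by (subst measure_pmf.prob_eq_1) auto
  then show ?thesis using \<theta> by simp
next
  case False
  then have "c > 0" using c by simp
  have "measure_pmf.prob p (- {x. X x \<le> c}) \<le> measure_pmf.prob p {x \<in> space p. c \<le> X x}"
    by (intro measure_pmf.finite_measure_mono) auto
  also have "\<dots> \<le> measure_pmf.expectation p X / c"
    using fin X \<open>c > 0\<close>
    by (intro integral_Markov_inequality_measure[where A = "{}"] integrable_measure_pmf_finite) auto
  also have "\<dots> \<le> \<theta>"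
    using E \<open>c > 0\<close> by (simp add: divide_le_eq)
  finally show ?thesis
    by (simp add: measure_pmf.prob_compl[of "{x. X x \<le> c}" p, simplified] Compl_eq_Diff_UNIV)
qed

subsection \<open>Sampling the window from a checkpoint\<close>

lemma sum_list_eq_sum_count:
  fixes g :: "'a \<Rightarrow> real"
  shows "(\<Sum>x\<leftarrow>xs. g x) = (\<Sum>x\<in>set xs. count_list xs x * g x)"
proof (induction xs)
  case (Cons y xs)
  have "(\<Sum>x\<in>set (y # xs). count_list (y # xs) x * g x) =
      (\<Sum>x\<in>set (y # xs). count_list xs x * g x) + (\<Sum>x\<in>set (y # xs). if x = y then g x else 0)"
    unfolding sum.distrib[symmetric] by (intro sum.cong) (auto simp: algebra_simps)
  also have "(\<Sum>x\<in>set (y # xs). count_list xs x * g x) = (\<Sum>x\<in>set xs. count_list xs x * g x)"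
    by (intro sum.mono_neutral_right) (auto simp: count_list_0_iff)
  finally show ?case using Cons by simp
qed simp

locale sampled_window =
  fixes n W s t a :: nat and \<Lambda> :: real and r :: "nat \<Rightarrow> real vec" and w :: "nat \<Rightarrow> nat"
  assumes \<Lambda>: "\<Lambda> > 0" and s: "s > 0" and a: "a \<le> t - W" "a < t"
    and carrier: "\<And>i. i < t \<Longrightarrow> r i \<in> carrier_vec n"
    and w_ge: "\<And>i. i < t \<Longrightarrow> \<Lambda> * square_norm n (r i) \<le> w i"
    and w_le: "\<And>i. i < t \<Longrightarrow> w i \<le> 2 * \<Lambda> * square_norm n (r i)"
    and tail: "tail_weight w a t \<le> 2 * tail_weight w (t - W) t"
begin

definition F :: real where
  "F = tail_weight w a t"

definition energy :: real where
  "energy = (\<Sum>i=t-W..<t. square_norm n (r i))"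

definition gram :: "nat \<times> nat \<Rightarrow> real" where
  "gram p = (\<Sum>i=t-W..<t. outer (r i) p)"

text \<open>Division by the sampling probability \<open>w i / F\<close> makes a single draw
  unbiased. Draws older than the window count as 0, so starting the reservoir early causes no
  bias.\<close>

definition estimate :: "nat \<times> nat \<Rightarrow> nat \<Rightarrow> real" where
  "estimate p i = (if t - W \<le> i then F / w i * outer (r i) p else 0)"

definition law :: "nat list pmf" where
  "law = indep_list (\<lambda>_. reservoir w a t) [0..<s]"

abbreviation entries :: "(nat \<times> nat) set" where
  "entries \<equiv> {..<n} \<times> {..<n}"

lemma energy_nonneg: "0 \<le> energy"
  by (simp add: energy_def sum_nonneg square_norm_nonneg)

lemma F_nonneg: "0 \<le> F"
  by (simp add: F_def)

text \<open>One factor 2 comes from the checkpoint starting too early, the other from rounding the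
  weights to integers.\<close>

lemma F_le: "F \<le> 4 * \<Lambda> * energy"
proof -
  have "F \<le> 2 * (\<Sum>i=t-W..<t. real (w i))"
    using of_nat_mono[OF tail, where ?'a = real] by (simp add: F_def tail_weight_def)
  also have "\<dots> \<le> 2 * (\<Sum>i=t-W..<t. 2 * \<Lambda> * square_norm n (r i))"
    using w_le by (intro mult_left_mono sum_mono) auto
  finally show ?thesis
    by (simp add: energy_def sum_distrib_left mult.assoc)
qed

text \<open>Weight 0 forces a zero row, so the value 0 that \<open>F / w i\<close> takes there is
  the correct contribution.\<close>

lemma outer_zero_weight:
  assumes "i < t" "w i = 0" "p \<in> entries"
  shows "outer (r i) p = 0"
proof -
  have "square_norm n (r i) = 0"
    using w_ge[OF assms(1)] assms(2) \<Lambda> square_norm_nonneg[of n "r i"]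
    by (simp add: mult_le_0_iff)
  then have "r i $ j = 0" if "j < n" for j
    using that by (simp add: square_norm_def sum_nonneg_eq_0_iff)
  then show ?thesis using assms(3) by (auto simp: outer_def)
qed

lemma expectation_F_mult:
  fixes \<phi> :: "nat \<Rightarrow> real"
  shows "measure_pmf.expectation (reservoir w a t) (\<lambda>i. F * \<phi> i) = (\<Sum>i=a..<t. w i * \<phi> i)"
  using expectation_reservoir[OF a(2), of w \<phi>] by (simp add: F_def)

lemma sum_window: "(\<Sum>i=a..<t. if t - W \<le> i then g i else 0) = (\<Sum>i=t-W..<t. g i :: real)"
  using a by (intro sum.mono_neutral_cong_right) auto

lemma expectation_estimate:
  assumes "p \<in> entries"
  shows "measure_pmf.expectation (reservoir w a t) (estimate p) = gram p"
proof -
  have "estimate p = (\<lambda>i. F * (if t - W \<le> i then outer (r i) p / w i else 0))"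
    by (auto simp: estimate_def)
  then have "measure_pmf.expectation (reservoir w a t) (estimate p) =
      (\<Sum>i=a..<t. w i * (if t - W \<le> i then outer (r i) p / w i else 0))"
    by (simp only: expectation_F_mult)
  also have "\<dots> = (\<Sum>i=a..<t. if t - W \<le> i then outer (r i) p else 0)"
    using outer_zero_weight[OF _ _ assms] by (intro sum.cong) auto
  finally show ?thesis
    by (simp add: sum_window gram_def)
qed

text \<open>Summed over all entries, the square of a rank-one matrix is the fourth power of the
  norm. So row \<open>i\<close> contributes \<open>F\<close> times norm^4 / \<open>w i\<close>, at
  most \<open>F\<close> times norm^2 / \<open>\<Lambda>\<close>, and \<open>F_le\<close> bounds the
  total.\<close>

lemma second_moment_estimate:
  "(\<Sum>p\<in>entries. measure_pmf.expectation (reservoir w a t) (\<lambda>i. (estimate p i)\<^sup>2)) \<le> 4 * energy\<^sup>2"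
proof -
  have fin: "finite (set_pmf (reservoir w a t))"
    using a(2) by (rule finite_set_reservoir)
  have "(\<Sum>p\<in>entries. measure_pmf.expectation (reservoir w a t) (\<lambda>i. (estimate p i)\<^sup>2)) =
      measure_pmf.expectation (reservoir w a t) (\<lambda>i. \<Sum>p\<in>entries. (estimate p i)\<^sup>2)"
    using fin by (subst Bochner_Integration.integral_sum) (auto intro: integrable_measure_pmf_finite)
  also have "(\<lambda>i. \<Sum>p\<in>entries. (estimate p i)\<^sup>2) =
      (\<lambda>i. F * (if t - W \<le> i then F * (square_norm n (r i) / w i)\<^sup>2 else 0))"
    by (auto simp: estimate_def power_mult_distrib power_divide sum_outer_square power2_eq_square[of F]
        simp flip: sum_distrib_left sum_divide_distrib)
  also have "measure_pmf.expectation (reservoir w a t) \<dots> =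
      (\<Sum>i=a..<t. if t - W \<le> i then F * (w i * (square_norm n (r i) / w i)\<^sup>2) else 0)"
    unfolding expectation_F_mult by (intro sum.cong) auto
  also have "\<dots> = F * (\<Sum>i=t-W..<t. w i * (square_norm n (r i) / w i)\<^sup>2)"
    by (simp add: sum_window sum_distrib_left)
  also have "\<dots> \<le> F * (\<Sum>i=t-W..<t. square_norm n (r i) / \<Lambda>)"
  proof (intro mult_left_mono sum_mono F_nonneg)
    fix i assume "i \<in> {t - W..<t}"
    then have "\<Lambda> * square_norm n (r i) \<le> w i"
      using w_ge by simp
    then show "w i * (square_norm n (r i) / w i)\<^sup>2 \<le> square_norm n (r i) / \<Lambda>"
      using \<Lambda> square_norm_nonneg[of n "r i"] mult_left_mono[of "\<Lambda> * square_norm n (r i)" "w i" "square_norm n (r i)"]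
      by (cases "w i = 0") (auto simp: power2_eq_square field_simps)
  qed
  also have "\<dots> = F * energy / \<Lambda>"
    by (simp add: energy_def flip: sum_divide_distrib)
  also have "\<dots> \<le> (4 * \<Lambda> * energy) * energy / \<Lambda>"
    using F_le energy_nonneg \<Lambda> by (intro divide_right_mono mult_right_mono) auto
  finally show ?thesis
    using \<Lambda> by (simp add: power2_eq_square)
qed

lemma sampling_error:
  assumes \<epsilon>: "\<epsilon> > 0" and s_ge: "48 / \<epsilon>\<^sup>2 \<le> s"
  shows "measure_pmf.prob law {is. L2_set (\<lambda>p. gram p - (\<Sum>i\<leftarrow>is. estimate p i) / s) entries
    \<le> \<epsilon> / 2 * energy} \<ge> 2 / 3"
proof -
  have fin: "finite (set_pmf (reservoir w a t))"
    using a(2) by (rule finite_set_reservoir)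
  then have finl: "finite (set_pmf law)"
    unfolding law_def by (rule finite_set_indep_list)
  define X where "X is = (\<Sum>p\<in>entries. (gram p - (\<Sum>i\<leftarrow>is. estimate p i) / s)\<^sup>2)" for "is"
  have X_nonneg: "0 \<le> X is" for "is"
    by (simp add: X_def sum_nonneg)
  have len: "length is = s" if "is \<in> set_pmf law" for "is"
    using that by (auto simp: law_def set_indep_list dest: list_all2_lengthD)
  have entry: "measure_pmf.expectation law (\<lambda>is. (gram p - (\<Sum>i\<leftarrow>is. estimate p i) / s)\<^sup>2) \<le>
      measure_pmf.expectation (reservoir w a t) (\<lambda>i. (estimate p i)\<^sup>2) / s" if "p \<in> entries" for p
  proof -
    have "measure_pmf.expectation law (\<lambda>is. (gram p - (\<Sum>i\<leftarrow>is. estimate p i) / s)\<^sup>2) =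
        measure_pmf.expectation law (\<lambda>is. ((\<Sum>i\<leftarrow>is. estimate p i) - real (length is) * gram p)\<^sup>2 / s\<^sup>2)"
    proof (intro integral_cong_AE)
      have "gram p - x / s = - ((x - s * gram p) / s)" for x
        using s by (simp add: field_simps)
      then have "(gram p - x / s)\<^sup>2 = (x - s * gram p)\<^sup>2 / s\<^sup>2" for x
        by (simp add: power_divide)
      then show "AE is in law. (gram p - (\<Sum>i\<leftarrow>is. estimate p i) / s)\<^sup>2 =
          ((\<Sum>i\<leftarrow>is. estimate p i) - real (length is) * gram p)\<^sup>2 / s\<^sup>2"
        using len by (simp add: AE_measure_pmf_iff)
    qed auto
    also have "\<dots> \<le> (s * measure_pmf.expectation (reservoir w a t) (\<lambda>i. (estimate p i)\<^sup>2)) / s\<^sup>2"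
      using second_moment_deviation[OF fin, of "[0..<s]" "estimate p"]
      by (simp add: expectation_estimate[OF that] law_def divide_right_mono)
    finally show ?thesis
      using s by (simp add: power2_eq_square)
  qed
  have "measure_pmf.expectation law X =
      (\<Sum>p\<in>entries. measure_pmf.expectation law (\<lambda>is. (gram p - (\<Sum>i\<leftarrow>is. estimate p i) / s)\<^sup>2))"
    unfolding X_def using finl
    by (subst Bochner_Integration.integral_sum) (auto intro: integrable_measure_pmf_finite)
  also have "\<dots> \<le> (\<Sum>p\<in>entries. measure_pmf.expectation (reservoir w a t) (\<lambda>i. (estimate p i)\<^sup>2)) / s"
    unfolding sum_divide_distrib by (intro sum_mono entry)
  also have "\<dots> \<le> 4 * energy\<^sup>2 / s"
    using second_moment_estimate by (intro divide_right_mono) auto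
  \<comment> \<open>48 = 4 * 3 * 4: the constant of \<open>second_moment_estimate\<close>, the
    failure probability 1/3, and the square of the half of \<open>\<epsilon>\<close> reserved for
    sampling.\<close>
  also have "\<dots> \<le> 1 / 3 * (\<epsilon> / 2 * energy)\<^sup>2"
  proof -
    have "1 / real s \<le> \<epsilon>\<^sup>2 / 48"
      using s s_ge \<epsilon> by (simp add: field_simps)
    then have "4 * energy\<^sup>2 * (1 / s) \<le> 4 * energy\<^sup>2 * (\<epsilon>\<^sup>2 / 48)"
      by (intro mult_left_mono) auto
    then show ?thesis by (simp add: power_mult_distrib power_divide)
  qed
  finally have "1 - 1 / 3 \<le> measure_pmf.prob law {is. X is \<le> (\<epsilon> / 2 * energy)\<^sup>2}"
    using finl by (intro markov_pmf X_nonneg) auto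
  also have "{is. X is \<le> (\<epsilon> / 2 * energy)\<^sup>2} =
      {is. L2_set (\<lambda>p. gram p - (\<Sum>i\<leftarrow>is. estimate p i) / s) entries \<le> \<epsilon> / 2 * energy}"
  proof -
    have "sqrt x \<le> \<epsilon> / 2 * energy \<longleftrightarrow> x \<le> (\<epsilon> / 2 * energy)\<^sup>2" for x
      using real_sqrt_le_iff[of x "(\<epsilon> / 2 * energy)\<^sup>2"] \<epsilon> energy_nonneg by simp
    then show ?thesis
      by (simp only: L2_set_def X_def)
  qed
  finally show ?thesis by simp
qed

section \<open>From drawn indices to distinct rescaled rows\<close>

definition selected :: "nat list \<Rightarrow> nat list" where
  "selected is = remdups (filter (\<lambda>i. t - W \<le> i \<and> w i > 0) is)"

text \<open>Reported positions must be distinct, so repeated draws are merged into one row with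
  their multiplicity in the factor. The root compensates for the square that scaling causes in the
  Gram matrix.\<close>

definition factor :: "nat list \<Rightarrow> nat \<Rightarrow> real" where
  "factor is i = sqrt (count_list is i * F / (s * w i))"

lemma factor_square: "(factor is i)\<^sup>2 = count_list is i * F / (s * w i)"
  using F_nonneg by (simp add: factor_def)

lemma sum_selected:
  assumes "\<And>i. i \<in> set is \<Longrightarrow> w i = 0 \<Longrightarrow> g i = 0"
  shows "(\<Sum>i\<leftarrow>selected is. (factor is i)\<^sup>2 * g i) =
    (\<Sum>i\<leftarrow>is. if t - W \<le> i then F / w i * g i else 0) / s"
proof -
  have "(\<Sum>i\<leftarrow>selected is. (factor is i)\<^sup>2 * g i) =
      (\<Sum>i \<in> {i \<in> set is. t - W \<le> i \<and> w i > 0}. (factor is i)\<^sup>2 * g i)"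
    by (simp add: selected_def sum_list_distinct_conv_sum_set)
  also have "\<dots> = (\<Sum>i \<in> set is. count_list is i * (if t - W \<le> i then F / w i * g i else 0) / s)"
    by (intro sum.mono_neutral_cong_left) (auto simp: factor_square mult.commute)
  also have "\<dots> = (\<Sum>i\<leftarrow>is. if t - W \<le> i then F / w i * g i else 0) / s"
    by (simp only: sum_list_eq_sum_count sum_divide_distrib)
  finally show ?thesis .
qed

context
  fixes "is" :: "nat list"
  assumes len: "length is = s" and lt: "\<And>i. i \<in> set is \<Longrightarrow> a \<le> i \<and> i < t"
begin

lemma set_selected: "i \<in> set (selected is) \<longleftrightarrow> i \<in> set is \<and> t - W \<le> i \<and> w i > 0"
  by (auto simp: selected_def)

lemma factor_pos:
  assumes "i \<in> set (selected is)"
  shows "factor is i > 0"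
proof -
  have i: "i \<in> set is" "w i > 0" "a \<le> i" "i < t"
    using assms lt[of i] by (auto simp: set_selected)
  then have "w i \<le> tail_weight w a t"
    unfolding tail_weight_def by (intro member_le_sum) auto
  then have "F > 0" using i by (simp add: F_def)
  moreover have "count_list is i > 0"
    using i count_list_0_iff[of "is" i] by simp
  ultimately show ?thesis using i s by (simp add: factor_def)
qed

lemma gram_selected:
  assumes "p \<in> entries"
  shows "(\<Sum>i\<leftarrow>selected is. outer (factor is i \<cdot>\<^sub>v r i) p) = (\<Sum>i\<leftarrow>is. estimate p i) / s"
proof -
  have "(\<Sum>i\<leftarrow>selected is. outer (factor is i \<cdot>\<^sub>v r i) p) =
      (\<Sum>i\<leftarrow>selected is. (factor is i)\<^sup>2 * outer (r i) p)"
    using lt carrier assms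
    by (intro arg_cong[of _ _ sum_list] map_cong refl outer_smult) (auto simp: set_selected)
  also have "\<dots> = (\<Sum>i\<leftarrow>is. estimate p i) / s"
    using outer_zero_weight[OF _ _ assms] lt by (subst sum_selected) (auto simp: estimate_def[abs_def])
  finally show ?thesis .
qed

text \<open>Weights proportional to norms flatten the contributions: each of the \<open>s\<close>
  draws adds at most \<open>F / (s * \<Lambda>)\<close>. The bound therefore holds for every
  outcome, and rounding costs no probability.\<close>

lemma energy_selected:
  "(\<Sum>i\<leftarrow>selected is. (factor is i)\<^sup>2 * square_norm n (r i)) \<le> 4 * energy"
proof -
  have zero: "square_norm n (r i) = 0" if "i \<in> set is" "w i = 0" for i
    using w_ge[of i] lt[of i] that \<Lambda> square_norm_nonneg[of n "r i"] by (simp add: mult_le_0_iff)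
  have "F / w i * square_norm n (r i) \<le> F / \<Lambda>" if "i < t" for i
  proof (cases "w i = 0")
    case False
    then show ?thesis
      using \<Lambda> F_nonneg mult_left_mono[OF w_ge[OF that] F_nonneg] by (simp add: field_simps)
  qed (use \<Lambda> F_nonneg in auto)
  then have "(\<Sum>i\<leftarrow>is. if t - W \<le> i then F / w i * square_norm n (r i) else 0) \<le> (\<Sum>i\<leftarrow>is. F / \<Lambda>)"
    using lt \<Lambda> F_nonneg by (intro sum_list_mono) auto
  also have "\<dots> = s * (F / \<Lambda>)"
    by (simp add: sum_list_triv len)
  finally have "(\<Sum>i\<leftarrow>selected is. (factor is i)\<^sup>2 * square_norm n (r i)) \<le> F / \<Lambda>"
    using s zero by (subst sum_selected) (auto simp: divide_le_eq mult.commute)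
  also have "\<dots> \<le> 4 * energy"
    using F_le \<Lambda> by (simp add: divide_le_eq mult.commute mult.left_commute)
  finally show ?thesis .
qed

text \<open>12 = 3 * 4, from \<open>outer_rounding\<close> and
  \<open>energy_selected\<close>.\<close>

lemma rounding_error:
  assumes \<delta>: "0 \<le> \<delta>" "\<delta> \<le> 1"
    and v: "\<And>i. i < t \<Longrightarrow> v i \<in> carrier_vec n"
    and close: "\<And>i j. i < t \<Longrightarrow> j < n \<Longrightarrow> \<bar>v i $ j - r i $ j\<bar> \<le> \<delta> * \<bar>r i $ j\<bar>"
  shows "L2_set (\<lambda>p. (\<Sum>i\<leftarrow>selected is. outer (factor is i \<cdot>\<^sub>v r i) p)
    - (\<Sum>i\<leftarrow>selected is. outer (factor is i \<cdot>\<^sub>v v i) p)) entries \<le> 12 * \<delta> * energy"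
proof -
  have dist: "distinct (selected is)"
    by (simp add: selected_def)
  have t: "i < t" if "i \<in> set (selected is)" for i
    using that lt by (auto simp: set_selected)
  let ?J = "set (selected is)"
  have "L2_set (\<lambda>p. (\<Sum>i\<leftarrow>selected is. outer (factor is i \<cdot>\<^sub>v r i) p)
      - (\<Sum>i\<leftarrow>selected is. outer (factor is i \<cdot>\<^sub>v v i) p)) entries =
    L2_set (\<lambda>p. \<Sum>i\<in>?J. (factor is i)\<^sup>2 * (outer (r i) p - outer (v i) p)) entries"
  proof (intro L2_set_cong refl)
    fix p assume "p \<in> entries"
    then show "(\<Sum>i\<leftarrow>selected is. outer (factor is i \<cdot>\<^sub>v r i) p)
      - (\<Sum>i\<leftarrow>selected is. outer (factor is i \<cdot>\<^sub>v v i) p) =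
      (\<Sum>i\<in>?J. (factor is i)\<^sup>2 * (outer (r i) p - outer (v i) p))"
      using t v carrier
      by (auto simp: sum_list_distinct_conv_sum_set[OF dist] outer_smult[where n = n]
          right_diff_distrib simp flip: sum_subtractf intro!: sum.cong)
  qed
  also have "\<dots> \<le> (\<Sum>i\<in>?J. L2_set (\<lambda>p. (factor is i)\<^sup>2 * (outer (r i) p - outer (v i) p)) entries)"
    by (rule L2_set_sum_le) simp
  also have "\<dots> \<le> (\<Sum>i\<in>?J. (factor is i)\<^sup>2 * (3 * \<delta> * square_norm n (r i)))"
  proof (rule sum_mono)
    fix i assume i: "i \<in> ?J"
    have "L2_set (\<lambda>p. outer (r i) p - outer (v i) p) entries \<le>
        sqrt (\<Sum>p\<in>entries. (3 * \<delta> * outer (r i) p)\<^sup>2)"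
      unfolding L2_set_def
    proof (intro real_sqrt_le_mono sum_mono)
      fix p assume "p \<in> entries"
      then have "\<bar>outer (r i) p - outer (v i) p\<bar> \<le> \<bar>3 * \<delta> * outer (r i) p\<bar>"
        using outer_rounding[OF close[OF t[OF i]] \<delta>, where n = n and p = p] \<delta> by (simp add: abs_mult)
      then show "(outer (r i) p - outer (v i) p)\<^sup>2 \<le> (3 * \<delta> * outer (r i) p)\<^sup>2"
        by (rule power2_le_iff_abs_le[THEN iffD2, OF abs_ge_zero, simplified])
    qed
    also have "\<dots> = 3 * \<delta> * square_norm n (r i)"
      using \<delta> by (simp add: power_mult_distrib sum_outer_square square_norm_nonneg real_sqrt_mult
          flip: sum_distrib_left)
    finally show "L2_set (\<lambda>p. (factor is i)\<^sup>2 * (outer (r i) p - outer (v i) p)) entries \<le>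
        (factor is i)\<^sup>2 * (3 * \<delta> * square_norm n (r i))"
      by (simp add: L2_set_right_distrib[symmetric] mult_left_mono)
  qed
  also have "\<dots> = 3 * \<delta> * (\<Sum>i\<leftarrow>selected is. (factor is i)\<^sup>2 * square_norm n (r i))"
    by (simp add: sum_list_distinct_conv_sum_set[OF dist] sum_distrib_left ac_simps)
  also have "\<dots> \<le> 3 * \<delta> * (4 * energy)"
    using energy_selected \<delta> by (intro mult_left_mono) auto
  finally show ?thesis by simp
qed

end

end

subsection \<open>Floating-point entries\<close>

text \<open>The magnitude is rounded down to a power of \<open>1 + \<delta>\<close> in units of
  \<open>1 / L\<close>. For nonzero entries \<open>\<bar>x\<bar> * L \<ge> 1\<close>, so the
  exponent is a natural number; \<open>sgn\<close> takes care of zero.\<close>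

definition round_entry :: "real \<Rightarrow> real \<Rightarrow> real \<Rightarrow> real" where
  "round_entry \<delta> L x = sgn x * ((1 + \<delta>) ^ nat \<lfloor>log (1 + \<delta>) (\<bar>x\<bar> * L)\<rfloor> / L)"

definition float_grid :: "real \<Rightarrow> real \<Rightarrow> real set" where
  "float_grid \<delta> L = (\<lambda>(\<sigma>, k). \<sigma> * ((1 + \<delta>) ^ k / L)) `
     ({-1, 0, 1} \<times> {..nat \<lfloor>log (1 + \<delta>) (L\<^sup>2)\<rfloor>})"

lemma finite_float_grid: "finite (float_grid \<delta> L)"
  by (simp add: float_grid_def)

lemma card_float_grid: "card (float_grid \<delta> L) \<le> 3 * (nat \<lfloor>log (1 + \<delta>) (L\<^sup>2)\<rfloor> + 1)"
  unfolding float_grid_def by (rule order_trans[OF card_image_le]) (auto simp: card_cartesian_product)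

lemma zero_in_float_grid: "0 \<in> float_grid \<delta> L"
  unfolding float_grid_def by (rule image_eqI[where x = "(0, 0)"]) auto

lemma round_entry_zero [simp]: "round_entry \<delta> L 0 = 0"
  by (simp add: round_entry_def)

context
  fixes \<delta> L x :: real
  assumes \<delta>: "\<delta> > 0" and L: "L > 0" and x: "1 / L \<le> \<bar>x\<bar>"
begin

lemma round_entry_in_float_grid:
  assumes "\<bar>x\<bar> \<le> L"
  shows "round_entry \<delta> L x \<in> float_grid \<delta> L"
proof -
  have "0 < 1 / L" using L by simp
  then have "0 < \<bar>x\<bar>" using x by (rule less_le_trans)
  then have "\<bar>x\<bar> * L \<le> L\<^sup>2" "0 < \<bar>x\<bar> * L"
    using assms x L by (simp_all add: power2_eq_square mult_right_mono)
  then have "log (1 + \<delta>) (\<bar>x\<bar> * L) \<le> log (1 + \<delta>) (L\<^sup>2)"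
    using \<delta> L by (subst log_le_cancel_iff) auto
  then have "nat \<lfloor>log (1 + \<delta>) (\<bar>x\<bar> * L)\<rfloor> \<le> nat \<lfloor>log (1 + \<delta>) (L\<^sup>2)\<rfloor>"
    by (intro nat_mono floor_mono)
  then show ?thesis
    unfolding round_entry_def float_grid_def
    by (intro image_eqI[where x = "(sgn x, nat \<lfloor>log (1 + \<delta>) (\<bar>x\<bar> * L)\<rfloor>)"]) (auto simp: sgn_real_def)
qed

lemma round_entry_close: "\<bar>round_entry \<delta> L x - x\<bar> \<le> \<delta> * \<bar>x\<bar>"
proof -
  define y where "y = \<bar>x\<bar> * L"
  define k where "k = nat \<lfloor>log (1 + \<delta>) y\<rfloor>"
  have y: "1 \<le> y" using x L by (simp add: y_def field_simps)
  then have "0 \<le> log (1 + \<delta>) y" using \<delta> by simp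
  then have k: "real k \<le> log (1 + \<delta>) y" "log (1 + \<delta>) y < real k + 1"
    unfolding k_def by linarith+
  have "(1 + \<delta>) ^ k = (1 + \<delta>) powr k"
    using \<delta> by (simp add: powr_realpow)
  also have "\<dots> \<le> y"
    using k(1) y \<delta> by (simp add: le_log_iff)
  finally have le: "(1 + \<delta>) ^ k \<le> y" .
  have "y < (1 + \<delta>) powr (real k + 1)"
    using k(2) y \<delta> by (simp add: log_less_iff)
  also have "\<dots> = (1 + \<delta>) ^ k * (1 + \<delta>)"
    using \<delta> by (simp add: powr_add powr_realpow)
  also have "\<dots> = (1 + \<delta>) ^ k + \<delta> * (1 + \<delta>) ^ k"
    by (simp add: algebra_simps)
  also have "\<dots> \<le> (1 + \<delta>) ^ k + \<delta> * y"
    using \<delta> le by (intro add_mono mult_left_mono) auto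
  finally have "y \<le> (1 + \<delta>) ^ k + \<delta> * y" by simp
  with le have "\<bar>(1 + \<delta>) ^ k - y\<bar> \<le> \<delta> * y" by simp
  then have "\<bar>(1 + \<delta>) ^ k / L - \<bar>x\<bar>\<bar> \<le> \<delta> * \<bar>x\<bar>"
    using L by (simp add: y_def field_simps abs_if split: if_splits)
  moreover have "round_entry \<delta> L x - x = sgn x * ((1 + \<delta>) ^ k / L - \<bar>x\<bar>)"
    by (simp add: round_entry_def k_def y_def right_diff_distrib sgn_mult_abs)
  moreover have "x \<noteq> 0" using x L by auto
  ultimately show ?thesis by (simp add: abs_mult)
qed

end

subsection \<open>Correctness\<close>

lemma window_eq: "window n W rs = mat_of_rows n (map ((!) rs) [length rs - W..<length rs])"
  by (simp add: window_def) (metis drop_map drop_upt map_nth plus_nat.add_0)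

lemma empty_answer:
  assumes "\<epsilon> > 0" "\<epsilon> \<ge> 1 \<or> us = []"
  shows "covariance_approximation \<epsilon> (mat_of_rows n us) ([], mat_of_rows n [])"
proof -
  have "covariance_error (mat_of_rows n us) (mat_of_rows n []) \<le> \<epsilon> * (frobenius_norm (mat_of_rows n us))\<^sup>2"
  proof (cases "us = []")
    case True
    then show ?thesis
      using covariance_error_empty_le[of n us] by (simp add: frobenius_norm_mat_of_rows)
  next
    case False
    then show ?thesis
      using covariance_error_empty_le[of n us] assms
        mult_right_mono[of 1 \<epsilon> "(frobenius_norm (mat_of_rows n us))\<^sup>2"] by simp
  qed
  then show ?thesis
    by (simp add: covariance_approximation_def Let_def selects_rows_def rescaled_rows_def
        rounding_of_def)
qed

locale row_sampler =
  fixes n W :: nat and L \<epsilon> :: real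
  assumes W: "W > 0" and L: "L \<ge> 1" and \<epsilon>: "\<epsilon> > 0" "\<epsilon> < 1"
begin

definition s :: nat where
  "s = nat \<lceil>48 / \<epsilon>\<^sup>2\<rceil>"

text \<open>Chosen so that \<open>12 * \<delta> = \<epsilon> / 2\<close>, the half of the error left
  to rounding.\<close>

definition \<delta> :: real where
  "\<delta> = \<epsilon> / 24"

definition weight :: "real vec \<Rightarrow> nat" where
  "weight r = nat \<lceil>L\<^sup>2 * square_norm n r\<rceil>"

definition code :: "real vec \<Rightarrow> real list" where
  "code r = map (\<lambda>j. round_entry \<delta> L (r $ j)) [0..<n]"

sublocale window_sampler W s weight code .

text \<open>With the clock at \<open>min W t\<close>, clock minus age is the position in the window,
  whether or not the window is full yet.\<close>

fun checkpoint_answer :: "nat \<Rightarrow> real list checkpoint \<Rightarrow> (nat \<times> real) list \<times> real mat" where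
  "checkpoint_answer \<tau> (g, f, us) =
    (let vs = remdups (filter (\<lambda>(g, m, x). g \<le> W \<and> m > 0) us);
         c = (\<lambda>u. sqrt (count_list us u * real f / (real s * real (fst (snd u)))))
     in (map (\<lambda>u. (\<tau> - fst u, c u)) vs,
         mat_of_rows n (map (\<lambda>u. c u \<cdot>\<^sub>v vec_of_list (snd (snd u))) vs)))"

definition memory_answer :: "real list memory \<Rightarrow> (nat \<times> real) list \<times> real mat" where
  "memory_answer \<sigma> = (if snd \<sigma> = [] then ([], mat_of_rows n [])
     else checkpoint_answer (fst \<sigma>) (hd (snd \<sigma>)))"

lemma s: "s > 0" "48 / \<epsilon>\<^sup>2 \<le> s"
  using \<epsilon> by (auto simp: s_def)

context
  fixes rs :: "real vec list"
  assumes bounded: "bounded_stream n L rs"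
begin

lemma row_entry:
  assumes "i < length rs" "j < n"
  shows "rs ! i $ j = 0 \<or> 1 / L \<le> \<bar>rs ! i $ j\<bar> \<and> \<bar>rs ! i $ j\<bar> \<le> L"
  using bounded assms by (auto simp: bounded_stream_def)

lemma row_carrier: "i < length rs \<Longrightarrow> rs ! i \<in> carrier_vec n"
  using bounded by (auto simp: bounded_stream_def)

lemma weight_ge: "L\<^sup>2 * square_norm n r \<le> weight r"
  unfolding weight_def by (rule real_nat_ceiling_ge)

text \<open>A nonzero row has an entry of size at least \<open>1 / L\<close>, so the quantity being
  rounded up is at least 1 and at most doubles. A zero row has weight 0.\<close>

lemma weight_le:
  assumes "i < length rs"
  shows "weight (rs ! i) \<le> 2 * L\<^sup>2 * square_norm n (rs ! i)"
proof (cases "\<forall>j<n. rs ! i $ j = 0")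
  case True
  then show ?thesis by (simp add: weight_def square_norm_def)
next
  case False
  then obtain j where j: "j < n" "1 / L \<le> \<bar>rs ! i $ j\<bar>"
    using row_entry[OF assms] by auto
  have "(1 / L)\<^sup>2 \<le> (rs ! i $ j)\<^sup>2"
    using power_mono[OF j(2), of 2] L by simp
  also have "\<dots> \<le> square_norm n (rs ! i)"
    unfolding square_norm_def using j(1) by (intro member_le_sum) auto
  finally have "1 \<le> L\<^sup>2 * square_norm n (rs ! i)"
    using L by (simp add: power_divide divide_le_eq mult.commute)
  then show ?thesis
    unfolding weight_def by linarith
qed

lemma code_close:
  assumes "i < length rs" "j < n"
  shows "\<bar>vec_of_list (code (rs ! i)) $ j - rs ! i $ j\<bar> \<le> \<delta> * \<bar>rs ! i $ j\<bar>"
proof (cases "rs ! i $ j = 0")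
  case True
  then show ?thesis using assms by (simp add: code_def vec_of_list_index)
next
  case False
  then have "1 / L \<le> \<bar>rs ! i $ j\<bar>"
    using row_entry[OF assms] by auto
  then show ?thesis
    using assms round_entry_close[of \<delta> L "rs ! i $ j"] \<epsilon> L
    by (simp add: code_def vec_of_list_index \<delta>_def)
qed

lemma code_carrier: "vec_of_list (code r) \<in> carrier_vec n"
  by (intro carrier_vecI) (simp add: code_def)

context
  fixes a :: nat
  assumes a: "a \<le> length rs - W" "a < length rs"
    "tail_weight (w rs) a (length rs) \<le> 2 * tail_weight (w rs) (length rs - W) (length rs)"
begin

interpretation sw: sampled_window n W s "length rs" a "L\<^sup>2" "(!) rs" "w rs"
  using L s a row_carrier weight_ge weight_le by unfold_locales (auto simp: w_def)

lemma frobenius_norm_window: "(frobenius_norm (window n W rs))\<^sup>2 = sw.energy"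
  by (simp add: window_eq frobenius_norm_mat_of_rows sw.energy_def sum_list_distinct_conv_sum_set o_def)

lemma checkpoint_answer_view:
  assumes "\<And>i. i \<in> set is \<Longrightarrow> a \<le> i \<and> i < length rs"
  shows "checkpoint_answer (min W (length rs)) (checkpoint_view rs (length rs) a is) =
    (map (\<lambda>i. (i - (length rs - W), sw.factor is i)) (sw.selected is),
     mat_of_rows n (map (\<lambda>i. sw.factor is i \<cdot>\<^sub>v vec_of_list (code (rs ! i))) (sw.selected is)))"
proof -
  let ?t = "length rs" and ?v = "sample_view rs (length rs)"
  let ?Q = "\<lambda>(g, m, x :: real list). g \<le> W \<and> m > (0 :: nat)"
  \<comment> \<open>Ages up to \<open>W\<close> are not saturated, so they tell the rows of the
    window apart even if the rows are equal; any older row shows age \<open>Suc W\<close>. Hence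
    duplicates and multiplicities can be read off the stored samples.\<close>
  have inj: "i = j" if "?t - W \<le> i" "i < ?t" "j < ?t" "?v i = ?v j" for i j
    using that by (auto simp: sample_view_def min_def split: if_splits)
  have Q: "?Q (?v i) \<longleftrightarrow> ?t - W \<le> i \<and> w rs i > 0" if "i < ?t" for i
    using that by (auto simp: sample_view_def)
  have "filter ?Q (map ?v is) = map ?v (filter (\<lambda>i. ?t - W \<le> i \<and> w rs i > 0) is)"
    unfolding filter_map using assms Q by (intro arg_cong[of _ _ "map ?v"] filter_cong) auto
  moreover have "remdups (map ?v xs) = map ?v (remdups xs)" if "inj_on ?v (set xs)" for xs
    using that by (induction xs) (auto simp: inj_on_def)
  moreover have "inj_on ?v (set (filter (\<lambda>i. ?t - W \<le> i \<and> w rs i > 0) is))"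
    using inj assms by (auto simp: inj_on_def)
  ultimately have sel: "remdups (filter ?Q (map ?v is)) = map ?v (sw.selected is)"
    by (simp add: sw.selected_def)
  have count: "count_list (map ?v is) (?v i) = count_list is i" if "i \<in> set (sw.selected is)" for i
  proof -
    have "count_list (map ?v xs) (?v i) = count_list xs i" if "set xs \<subseteq> set is" for xs
      using that
    proof (induction xs)
      case (Cons j xs)
      moreover have "?v i = ?v j \<longleftrightarrow> i = j"
        using inj[of i j] assms[of i] assms[of j] Cons.prems \<open>i \<in> set (sw.selected is)\<close>
        by (auto simp: sw.selected_def)
      ultimately show ?case by auto
    qed simp
    then show ?thesis by simp
  qed
  have factor: "sqrt (count_list (map ?v is) (?v i) * real (tail_weight (w rs) a ?t) /
      (real s * real (fst (snd (?v i))))) = sw.factor is i" if "i \<in> set (sw.selected is)" for i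
    unfolding count[OF that] by (simp add: sw.factor_def sw.F_def sample_view_def)
  have pos: "min W ?t - fst (?v i) = i - (?t - W)" if "i \<in> set (sw.selected is)" for i
    using that assms[of i] by (auto simp: sample_view_def sw.selected_def)
  show ?thesis
    unfolding checkpoint_view_def checkpoint_answer.simps Let_def sel map_map o_def
    using factor pos by (auto simp: sample_view_def intro!: arg_cong[of _ _ "mat_of_rows n"])
qed

lemma rescaled_rows_window:
  assumes "\<And>i. i \<in> set js \<Longrightarrow> length rs - W \<le> i \<and> i < length rs"
  shows "rescaled_rows (window n W rs) (map (\<lambda>i. (i - (length rs - W), c i)) js) =
    mat_of_rows n (map (\<lambda>i. c i \<cdot>\<^sub>v rs ! i) js)"
proof -
  have "row (window n W rs) (i - (length rs - W)) = rs ! i" if "i \<in> set js" for i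
    using assms[OF that] row_carrier[of i]
    by (subst window_eq, subst mat_of_rows_row) auto
  then show ?thesis
    by (auto simp: rescaled_rows_def window_def intro!: arg_cong[of _ _ "mat_of_rows n"])
qed

lemma covariance_approximation_checkpoint:
  assumes len: "length is = s" and lt: "\<And>i. i \<in> set is \<Longrightarrow> a \<le> i \<and> i < length rs"
    and good: "L2_set (\<lambda>p. sw.gram p - (\<Sum>i\<leftarrow>is. sw.estimate p i) / s) sw.entries
      \<le> \<epsilon> / 2 * sw.energy"
  shows "covariance_approximation \<epsilon> (window n W rs)
    (checkpoint_answer (min W (length rs)) (checkpoint_view rs (length rs) a is))"
proof -
  let ?t = "length rs" and ?A = "window n W rs" and ?js = "sw.selected is"
  let ?\<kappa> = "sw.factor is" and ?v = "\<lambda>i. vec_of_list (code (rs ! i))"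
  define sel where "sel = map (\<lambda>i. (i - (?t - W), ?\<kappa> i)) ?js"
  define B where "B = mat_of_rows n (map (\<lambda>i. ?\<kappa> i \<cdot>\<^sub>v rs ! i) ?js)"
  define B' where "B' = mat_of_rows n (map (\<lambda>i. ?\<kappa> i \<cdot>\<^sub>v ?v i) ?js)"
  have js: "?t - W \<le> i \<and> i < ?t" if "i \<in> set ?js" for i
    using that lt by (auto simp: sw.set_selected[OF len lt])
  have \<kappa>: "?\<kappa> i > 0" if "i \<in> set ?js" for i
    using that lt by (intro sw.factor_pos[OF len]) auto
  have \<delta>: "0 \<le> \<delta>" "\<delta> \<le> 1" "\<delta> \<le> \<epsilon>" using \<epsilon> by (auto simp: \<delta>_def)
  have A: "?A = mat_of_rows n (map ((!) rs) [?t - W..<?t])"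
    by (rule window_eq)
  have gram: "(\<Sum>u\<leftarrow>map ((!) rs) [?t - W..<?t]. outer u p) = sw.gram p" for p
    by (simp add: sw.gram_def sum_list_distinct_conv_sum_set o_def)
  have B: "rescaled_rows ?A sel = B"
    unfolding sel_def B_def using js by (rule rescaled_rows_window)
  have AB: "covariance_error ?A B \<le> \<epsilon> / 2 * sw.energy"
  proof -
    have "covariance_error ?A B =
        L2_set (\<lambda>p. sw.gram p - (\<Sum>i\<leftarrow>is. sw.estimate p i) / s) sw.entries"
      unfolding A B_def covariance_error_mat_of_rows gram
      using lt by (intro L2_set_cong refl) (simp add: o_def sw.gram_selected[OF len])
    with good show ?thesis by simp
  qed
  \<comment> \<open>Triangle inequality through the exact matrix \<open>B\<close>, spending half of
    \<open>\<epsilon>\<close> on sampling and half on rounding.\<close>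
  have "covariance_error ?A B' \<le> covariance_error ?A B +
      L2_set (\<lambda>p. (\<Sum>i\<leftarrow>?js. outer (?\<kappa> i \<cdot>\<^sub>v rs ! i) p) - (\<Sum>i\<leftarrow>?js. outer (?\<kappa> i \<cdot>\<^sub>v ?v i) p)) sw.entries"
    unfolding A B_def B'_def covariance_error_mat_of_rows
    by (rule order_trans[OF _ L2_set_triangle_ineq]) (simp add: o_def)
  also have "\<dots> \<le> \<epsilon> / 2 * sw.energy + 12 * \<delta> * sw.energy"
    using lt \<delta> by (intro add_mono AB sw.rounding_error[OF len] code_carrier code_close) auto
  also have "\<dots> = \<epsilon> * sw.energy"
    by (simp add: \<delta>_def)
  finally have AB': "covariance_error ?A B' \<le> \<epsilon> * sw.energy" .
  have "selects_rows ?A sel"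
  proof -
    have "inj_on (\<lambda>i. i - (?t - W)) (set ?js)"
      using js by (auto simp: inj_on_def) (metis eq_diff_iff)
    moreover have "distinct ?js"
      by (simp add: sw.selected_def)
    ultimately show ?thesis
      using js \<kappa> W by (auto simp: selects_rows_def sel_def o_def distinct_map window_def less_diff_conv)
  qed
  moreover have "covariance_error ?A B \<le> \<epsilon> * sw.energy"
    using AB mult_right_mono[of "\<epsilon> / 2" \<epsilon> sw.energy] \<epsilon> sw.energy_nonneg by linarith
  moreover have "rounding_of \<epsilon> B B'"
    unfolding rounding_of_def
  proof (intro conjI allI impI)
    fix k j
    assume "k < dim_row B" "j < dim_col B"
    then have kj: "k < length ?js" "j < n" by (auto simp: B_def)
    define i where "i = ?js ! k"
    have i: "i < ?t" "?\<kappa> i > 0"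
      using js[of i] \<kappa>[of i] kj by (auto simp: i_def)
    have "\<bar>?v i $ j - rs ! i $ j\<bar> \<le> \<epsilon> * \<bar>rs ! i $ j\<bar>"
      using code_close[OF i(1) kj(2)] \<delta>(3) mult_right_mono[of \<delta> \<epsilon> "\<bar>rs ! i $ j\<bar>"] by simp
    then have "?\<kappa> i * \<bar>?v i $ j - rs ! i $ j\<bar> \<le> ?\<kappa> i * (\<epsilon> * \<bar>rs ! i $ j\<bar>)"
      using i(2) by (intro mult_left_mono) auto
    also have "?\<kappa> i * \<bar>?v i $ j - rs ! i $ j\<bar> = \<bar>?\<kappa> i * ?v i $ j - ?\<kappa> i * rs ! i $ j\<bar>"
      using i(2) by (simp add: abs_mult flip: right_diff_distrib)
    finally show "\<bar>B' $$ (k, j) - B $$ (k, j)\<bar> \<le> \<epsilon> * \<bar>B $$ (k, j)\<bar>"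
      using kj carrier_vecD[OF row_carrier[OF i(1)]] carrier_vecD[OF code_carrier[of "rs ! i"]] i(2)
      by (simp add: B_def B'_def mat_of_rows_def i_def[symmetric] abs_mult mult.left_commute)
  qed (simp_all add: B_def B'_def)
  ultimately show ?thesis
    using AB' lt
    by (simp add: checkpoint_answer_view covariance_approximation_def Let_def B frobenius_norm_window
        flip: sel_def B'_def)
qed

lemma checkpoint_correct:
  "measure_pmf.prob (checkpoint_law rs (length rs) a)
    {c. covariance_approximation \<epsilon> (window n W rs) (checkpoint_answer (min W (length rs)) c)} \<ge> 2 / 3"
proof -
  have "2 / 3 \<le> measure_pmf.prob sw.law {is. L2_set (\<lambda>p. sw.gram p - (\<Sum>i\<leftarrow>is. sw.estimate p i) / s)
      sw.entries \<le> \<epsilon> / 2 * sw.energy}"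
    using \<epsilon> s by (intro sw.sampling_error) auto
  also have "\<dots> \<le> measure_pmf.prob sw.law {is. covariance_approximation \<epsilon> (window n W rs)
      (checkpoint_answer (min W (length rs)) (checkpoint_view rs (length rs) a is))}"
  proof (intro measure_pmf.finite_measure_mono_AE)
    have "length is = s \<and> (\<forall>i\<in>set is. a \<le> i \<and> i < length rs)" if "is \<in> set_pmf sw.law" for "is"
      using that set_reservoir[OF a(2), of "w rs"]
      by (fastforce simp: sw.law_def set_indep_list list_all2_conv_all_nth in_set_conv_nth)
    then show "AE is in sw.law. is \<in> {is. L2_set (\<lambda>p. sw.gram p - (\<Sum>i\<leftarrow>is. sw.estimate p i) / s)
        sw.entries \<le> \<epsilon> / 2 * sw.energy} \<longrightarrow> is \<in> {is. covariance_approximation \<epsilon> (window n W rs)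
        (checkpoint_answer (min W (length rs)) (checkpoint_view rs (length rs) a is))}"
      by (auto simp: AE_measure_pmf_iff intro!: covariance_approximation_checkpoint)
  qed auto
  finally show ?thesis
    by (simp add: checkpoint_law_def sw.law_def vimage_def)
qed

end

lemma memory_correct:
  "measure_pmf.prob (map_pmf memory_answer (abstract_run (0, []) memory_step rs))
    {out. covariance_approximation \<epsilon> (window n W rs) out} \<ge> 2 / 3"
proof (cases "length rs > 0")
  case False
  then show ?thesis
    using empty_answer[of \<epsilon> "[]" n] \<epsilon>
    by (simp add: abstract_run_def memory_answer_def window_def indicator_def)
next
  case True
  let ?t = "length rs"
  obtain a as where a: "alive W (w rs) ?t = a # as" "a \<le> ?t - W" "a < ?t"
    "tail_weight (w rs) a ?t \<le> 2 * tail_weight (w rs) (?t - W) ?t"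
    using alive_head[OF W True] by metis
  have "abstract_run (0, []) memory_step rs =
      map_pmf (Pair (min W ?t)) (indep_list (checkpoint_law rs ?t) (a # as))"
    using memory_law[OF W, of ?t rs] a(1) by simp
  then have "map_pmf memory_answer (abstract_run (0, []) memory_step rs) =
      map_pmf (\<lambda>cs. memory_answer (min W ?t, cs)) (indep_list (checkpoint_law rs ?t) (a # as))"
    by (simp only: pmf.map_comp o_def)
  also have "\<dots> = map_pmf (\<lambda>cs. checkpoint_answer (min W ?t) (hd cs))
      (indep_list (checkpoint_law rs ?t) (a # as))"
    by (intro map_pmf_cong refl) (auto simp: memory_answer_def)
  also have "\<dots> = map_pmf (checkpoint_answer (min W ?t))
      (map_pmf hd (indep_list (checkpoint_law rs ?t) (a # as)))"
    by (simp only: pmf.map_comp o_def)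
  also have "\<dots> = map_pmf (checkpoint_answer (min W ?t)) (checkpoint_law rs ?t a)"
    by (simp only: map_hd_indep_list)
  finally show ?thesis
    using checkpoint_correct[OF a(2-4)] by (simp add: vimage_def)
qed

end

end

subsection \<open>Counting memory states\<close>

lemma card_lists_le_length:
  assumes "finite X" "X \<noteq> {}"
  shows "card {xs. set xs \<subseteq> X \<and> length xs \<le> m} \<le> (m + 1) * card X ^ m"
proof -
  have "card X \<ge> 1" using assms by (simp add: Suc_leI card_gt_0_iff)
  then have "(\<Sum>i\<le>m. card X ^ i) \<le> (\<Sum>i\<le>m. card X ^ m)"
    by (intro sum_mono power_increasing) auto
  then show ?thesis by (simp add: card_lists_length_le[OF assms(1)])
qed

lemma le_power_nat_ceiling_log:
  fixes m :: nat
  assumes "m > 0"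
  shows "m \<le> 2 ^ nat \<lceil>log 2 m\<rceil>"
proof -
  have "real m = 2 powr log 2 m" using assms by simp
  also have "\<dots> \<le> 2 powr real (nat \<lceil>log 2 m\<rceil>)"
    by (intro powr_mono real_nat_ceiling_ge) simp
  finally have "real m \<le> real (2 ^ nat \<lceil>log 2 m\<rceil>)"
    by (simp add: powr_realpow)
  then show ?thesis by (simp only: of_nat_le_iff)
qed

context row_sampler
begin

definition max_weight :: nat where
  "max_weight = nat \<lceil>real n * L ^ 4\<rceil>"

text \<open>The window weighs at most \<open>W * max_weight\<close>; the factor 2 is that of
  \<open>alive_tail_weight_le\<close>.\<close>

definition max_total :: nat where
  "max_total = 2 * W * max_weight"

text \<open>One width serves all integers in the memory. There are \<open>W + 2\<close> possible
  ages, from 0 to \<open>Suc W\<close>.\<close>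

definition counter_bits :: nat where
  "counter_bits = nat \<lceil>log 2 (real (max_total + max_weight + W + 2))\<rceil>"

definition entry_bits :: nat where
  "entry_bits = nat \<lceil>log 2 (card (float_grid \<delta> L))\<rceil>"

text \<open>The bound of \<open>length_alive_le\<close> with
  \<open>j = counter_bits\<close>.\<close>

definition max_checkpoints :: nat where
  "max_checkpoints = 2 * counter_bits + 2"

definition samples :: "real list sample set" where
  "samples = {..Suc W} \<times> {..max_weight} \<times> {x. set x \<subseteq> float_grid \<delta> L \<and> length x = n}"

definition checkpoints :: "real list checkpoint set" where
  "checkpoints = {..Suc W} \<times> {..max_total} \<times> {us. set us \<subseteq> samples \<and> length us = s}"

definition memories :: "real list memory set" where
  "memories = {..W} \<times> {cs. set cs \<subseteq> checkpoints \<and> length cs \<le> max_checkpoints}"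

text \<open>The separate summand \<open>max_checkpoints\<close> pays for the unknown length of the
  list, through m + 1 \<le> 2^m.\<close>

definition memory_bits :: nat where
  "memory_bits = counter_bits + max_checkpoints +
     max_checkpoints * (2 * counter_bits + s * (2 * counter_bits + n * entry_bits))"

lemma counter_bound: "max_total + max_weight + W + 2 \<le> 2 ^ counter_bits"
  using le_power_nat_ceiling_log[of "max_total + max_weight + W + 2"]
  unfolding counter_bits_def by simp

lemma finite_samples: "finite samples" and finite_checkpoints: "finite checkpoints"
  and finite_memories: "finite memories"
proof -
  show "finite samples"
    unfolding samples_def using finite_lists_length_eq[OF finite_float_grid] by simp
  then show "finite checkpoints"
    unfolding checkpoints_def using finite_lists_length_eq by auto
  then show "finite memories"
    unfolding memories_def using finite_lists_length_le by auto
qed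

lemma card_memories: "card memories \<le> 2 ^ memory_bits"
proof -
  have "card (float_grid \<delta> L) > 0"
    using zero_in_float_grid[of \<delta> L] finite_float_grid[of \<delta> L] by (auto simp: card_gt_0_iff)
  then have grid: "card (float_grid \<delta> L) \<le> 2 ^ entry_bits"
    unfolding entry_bits_def by (rule le_power_nat_ceiling_log)
  have "card samples = (W + 2) * ((max_weight + 1) * card (float_grid \<delta> L) ^ n)"
    by (simp add: samples_def card_cartesian_product card_lists_length_eq finite_float_grid)
  also have "\<dots> \<le> 2 ^ counter_bits * (2 ^ counter_bits * (2 ^ entry_bits) ^ n)"
    using counter_bound grid by (intro mult_mono power_mono) auto
  also have "\<dots> = 2 ^ (2 * counter_bits + n * entry_bits)"
    by (simp add: power_add power_mult mult_2 mult.commute[of n])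
  finally have samples: "card samples \<le> 2 ^ (2 * counter_bits + n * entry_bits)" .
  have "card checkpoints = (W + 2) * ((max_total + 1) * card samples ^ s)"
    by (simp add: checkpoints_def card_cartesian_product card_lists_length_eq finite_samples)
  also have "\<dots> \<le> 2 ^ counter_bits * (2 ^ counter_bits * (2 ^ (2 * counter_bits + n * entry_bits)) ^ s)"
    using counter_bound samples by (intro mult_mono power_mono) auto
  also have "\<dots> = 2 ^ (2 * counter_bits + s * (2 * counter_bits + n * entry_bits))"
  proof -
    have "(2 :: nat) ^ b * (2 ^ b * (2 ^ x) ^ s) = 2 ^ (2 * b + s * x)" for b x
      by (simp add: power_add mult_2 mult.commute[of s] flip: power_mult)
    then show ?thesis .
  qed
  finally have checkpoints:
    "card checkpoints \<le> 2 ^ (2 * counter_bits + s * (2 * counter_bits + n * entry_bits))" .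
  have "(0, 0, replicate s (0, 0, replicate n 0)) \<in> checkpoints"
    using zero_in_float_grid by (auto simp: checkpoints_def samples_def)
  then have ne: "checkpoints \<noteq> {}" by blast
  have "card memories = (W + 1) * card {cs. set cs \<subseteq> checkpoints \<and> length cs \<le> max_checkpoints}"
    by (simp add: memories_def card_cartesian_product)
  also have "\<dots> \<le> (W + 1) * ((max_checkpoints + 1) * card checkpoints ^ max_checkpoints)"
    using card_lists_le_length[OF finite_checkpoints ne] by (intro mult_left_mono) auto
  also have "\<dots> \<le> 2 ^ counter_bits * (2 ^ max_checkpoints *
      (2 ^ (2 * counter_bits + s * (2 * counter_bits + n * entry_bits))) ^ max_checkpoints)"
    using counter_bound checkpoints Suc_leI[OF less_exp[of max_checkpoints]]
    by (intro mult_mono power_mono) auto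
  also have "\<dots> = 2 ^ memory_bits"
  proof -
    have "(2 :: nat) ^ b * (2 ^ m * (2 ^ x) ^ m) = 2 ^ (b + m + m * x)" for b m x
      by (simp add: power_add mult.commute[of m] flip: power_mult)
    then show ?thesis unfolding memory_bits_def .
  qed
  finally show ?thesis .
qed

lemma abstract_run_in_memories:
  assumes bounded: "bounded_stream n L rs" and t: "t \<le> length rs"
  shows "set_pmf (abstract_run (0, []) memory_step (take t rs)) \<subseteq> memories"
proof -
  have weight: "w rs i \<le> max_weight" if "i < t" for i
  proof -
    have "(rs ! i $ j)\<^sup>2 \<le> L\<^sup>2" if "j < n" for j
    proof -
      have "\<bar>rs ! i $ j\<bar> \<le> L"
        using row_entry[OF bounded, of i j] that \<open>i < t\<close> t L by auto
      then show ?thesis using L by (simp add: abs_le_square_iff[symmetric])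
    qed
    then have "square_norm n (rs ! i) \<le> real n * L\<^sup>2"
      unfolding square_norm_def using sum_mono[of "{..<n}" "\<lambda>j. (rs ! i $ j)\<^sup>2" "\<lambda>_. L\<^sup>2"] by simp
    then have "L\<^sup>2 * square_norm n (rs ! i) \<le> L\<^sup>2 * (real n * L\<^sup>2)"
      by (rule mult_left_mono) simp
    also have "\<dots> = real n * L ^ 4"
      by (simp add: power4_eq_xxxx power2_eq_square)
    finally show ?thesis
      unfolding w_def weight_def max_weight_def by (intro nat_mono ceiling_mono)
  qed
  have "tail_weight (w rs) (t - W) t \<le> (\<Sum>i=t-W..<t. max_weight)"
    unfolding tail_weight_def by (intro sum_mono weight) auto
  also have "\<dots> = (t - (t - W)) * max_weight"
    by simp
  also have "\<dots> \<le> W * max_weight"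
    by (intro mult_right_mono) auto
  finally have total: "2 * tail_weight (w rs) (t - W) t \<le> max_total"
    by (simp add: max_total_def)
  have sample: "sample_view rs t i \<in> samples" if "i < t" for i
  proof -
    have "round_entry \<delta> L (rs ! i $ j) \<in> float_grid \<delta> L" if "j < n" for j
      using row_entry[OF bounded, of i j] that \<open>i < t\<close> t L \<epsilon> zero_in_float_grid
        round_entry_in_float_grid[of \<delta> L "rs ! i $ j"]
      by (cases "rs ! i $ j = 0") (auto simp: \<delta>_def)
    then show ?thesis
      using weight[OF that] by (auto simp: samples_def sample_view_def code_def)
  qed
  have checkpoint: "c \<in> checkpoints"
    if a: "a \<in> set (alive W (w rs) t)" and c: "c \<in> set_pmf (checkpoint_law rs t a)" for a c
  proof -
    obtain "is" where law: "is \<in> set_pmf (indep_list (\<lambda>_. reservoir (w rs) a t) [0..<s])"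
      "c = checkpoint_view rs t a is"
      using c by (auto simp: checkpoint_law_def)
    have "length is = s \<and> (\<forall>i\<in>set is. i < t)"
      using law(1) set_reservoir[OF alive_less[OF a], of "w rs"]
      by (fastforce simp: set_indep_list list_all2_conv_all_nth in_set_conv_nth)
    moreover have "tail_weight (w rs) a t \<le> max_total"
      using alive_tail_weight_le[OF W a] total by simp
    ultimately show ?thesis
      using sample law(2) by (auto simp: checkpoints_def checkpoint_view_def)
  qed
  have "2 * tail_weight (w rs) (t - W) t < 2 ^ counter_bits"
    using total counter_bound by linarith
  then have len: "length (alive W (w rs) t) \<le> max_checkpoints"
    unfolding max_checkpoints_def by (rule length_alive_le[OF W])
  show ?thesis
  proof
    fix \<sigma> assume "\<sigma> \<in> set_pmf (abstract_run (0, []) memory_step (take t rs))"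
    then obtain cs where \<sigma>: "\<sigma> = (min W t, cs)"
      and cs: "list_all2 (\<lambda>a c. c \<in> set_pmf (checkpoint_law rs t a)) (alive W (w rs) t) cs"
      by (auto simp: memory_law[OF W t] set_indep_list)
    have "set cs \<subseteq> checkpoints"
      using cs checkpoint by (fastforce simp: list_all2_conv_all_nth in_set_conv_nth)
    moreover have "length cs \<le> max_checkpoints"
      using len list_all2_lengthD[OF cs] by simp
    ultimately show "\<sigma> \<in> memories"
      by (simp add: \<sigma> memories_def)
  qed
qed

lemma row_sampling_algorithm:
  obtains alg where
    "\<And>rs. bounded_stream n L rs \<Longrightarrow> measure_pmf.prob (run alg rs)
       {h. covariance_approximation \<epsilon> (window n W rs) (answer alg (hd h))} \<ge> 2 / 3"
    "\<And>rs h. h \<in> set_pmf (run alg rs) \<Longrightarrow> peak_space h \<le> memory_bits"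
proof -
  obtain alg where law: "\<And>rs. (\<And>k. k \<le> length rs \<Longrightarrow>
        set_pmf (abstract_run (0, []) memory_step (take k rs)) \<subseteq> memories) \<Longrightarrow>
       map_pmf (\<lambda>h. answer alg (hd h)) (run alg rs) =
       map_pmf memory_answer (abstract_run (0, []) memory_step rs)"
    and space: "\<And>rs h. h \<in> set_pmf (run alg rs) \<Longrightarrow> peak_space h \<le> memory_bits"
    using bit_string_algorithm[OF finite_memories card_memories] by blast
  have "measure_pmf.prob (run alg rs)
      {h. covariance_approximation \<epsilon> (window n W rs) (answer alg (hd h))} \<ge> 2 / 3"
    if "bounded_stream n L rs" for rs
  proof -
    have "measure_pmf.prob (run alg rs)
        {h. covariance_approximation \<epsilon> (window n W rs) (answer alg (hd h))} =
      measure_pmf.prob (map_pmf (\<lambda>h. answer alg (hd h)) (run alg rs))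
        {out. covariance_approximation \<epsilon> (window n W rs) out}"
      by (simp add: vimage_def)
    also have "\<dots> \<ge> 2 / 3"
    proof -
      have "map_pmf (\<lambda>h. answer alg (hd h)) (run alg rs) =
          map_pmf memory_answer (abstract_run (0, []) memory_step rs)"
        by (rule law) (rule abstract_run_in_memories[OF that])
      then show ?thesis using memory_correct[OF that] by simp
    qed
    finally show ?thesis .
  qed
  with space show thesis by (intro that)
qed

end

subsection \<open>The space bound\<close>

lemma of_nat_nat_ceiling_le:
  fixes x :: real
  assumes "0 \<le> x"
  shows "real (nat \<lceil>x\<rceil>) \<le> x + 1"
  using assms by linarith

context row_sampler
begin

text \<open>288 = 3 * 96 counts the three signs, and 96 = 2 * 2 * 24 comes from
  \<open>L\<^sup>2\<close>, from \<open>ln (1 + \<delta>) \<ge> \<delta> / 2\<close> and from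
  \<open>\<delta> = \<epsilon> / 24\<close>. From \<open>n = 4\<close> on,
  \<open>log 2 (log 2 n)\<close> is at least 1, so additive constants become part of the
  factor.\<close>

lemma entry_bits_le:
  assumes n: "n \<ge> 4" and L_le: "L \<le> real n ^ d"
  shows "entry_bits \<le> (log 2 (288 * d + 3) + 2) * (log 2 (log 2 n) + log 2 (1 / \<epsilon>))"
proof -
  have logn: "log 2 n \<ge> 2"
    using n le_log_iff[of 2 n 2] by simp
  then have loglog: "log 2 (log 2 n) \<ge> 1"
    using le_log_iff[of 2 "log 2 n" 1] by simp
  have \<epsilon>': "1 / \<epsilon> \<ge> 1" "log 2 (1 / \<epsilon>) \<ge> 0" using \<epsilon> by simp_all
  have \<delta>: "\<delta> > 0" "\<delta> < 1" using \<epsilon> by (auto simp: \<delta>_def)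
  have "ln L \<le> ln (real n ^ d)"
    using L L_le by (intro ln_mono) auto
  also have "\<dots> = d * ln n"
    using n by (simp add: ln_realpow)
  also have "\<dots> \<le> d * log 2 n"
  proof (intro mult_left_mono)
    have "ln 2 \<le> (1 :: real)" using ln_le_minus_one[of 2] by simp
    then have "ln n * ln 2 \<le> ln n * 1"
      using n by (intro mult_left_mono) auto
    then show "ln n \<le> log 2 n" by (simp add: log_def field_simps)
  qed simp
  finally have lnL: "ln L \<le> d * log 2 n" .
  have "\<delta> / 2 \<le> \<delta> / (1 + \<delta>)"
    using \<delta> by (intro divide_left_mono) auto
  also have "\<dots> \<le> ln (1 + \<delta>)"
    using ln_le_minus_one[of "1 / (1 + \<delta>)"] \<delta> by (simp add: ln_div field_simps)
  finally have "ln (1 + \<delta>) \<ge> \<delta> / 2" .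
  have "log (1 + \<delta>) (L\<^sup>2) = 2 * ln L / ln (1 + \<delta>)"
    using L by (simp add: log_def ln_realpow)
  also have "\<dots> \<le> 2 * ln L / (\<delta> / 2)"
    using \<open>ln (1 + \<delta>) \<ge> \<delta> / 2\<close> \<delta> L by (intro divide_left_mono) auto
  also have "\<dots> = 96 * ln L / \<epsilon>"
    by (simp add: \<delta>_def)
  also have "\<dots> \<le> 96 * (d * log 2 n) / \<epsilon>"
    using lnL \<epsilon> by (intro divide_right_mono) auto
  finally have log_le: "log (1 + \<delta>) (L\<^sup>2) \<le> 96 * d * log 2 n / \<epsilon>"
    by simp
  have one: "1 \<le> log 2 n / \<epsilon>"
    using logn \<epsilon> by (simp add: field_simps)
  have "real (card (float_grid \<delta> L)) \<le> 3 * (real (nat \<lfloor>log (1 + \<delta>) (L\<^sup>2)\<rfloor>) + 1)"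
    using of_nat_mono[OF card_float_grid[of \<delta> L], where ?'a = real] by simp
  also have "\<dots> \<le> 3 * (96 * d * log 2 n / \<epsilon> + log 2 n / \<epsilon>)"
  proof -
    have "real (nat \<lfloor>log (1 + \<delta>) (L\<^sup>2)\<rfloor>) \<le> log (1 + \<delta>) (L\<^sup>2)"
      using L \<delta> by (intro of_nat_floor) (simp add: zero_le_log_cancel_iff)
    with log_le one show ?thesis by simp
  qed
  also have "\<dots> = (288 * d + 3) * (log 2 n * (1 / \<epsilon>))"
    by (simp add: algebra_simps add_divide_distrib)
  finally have card: "real (card (float_grid \<delta> L)) \<le> (288 * d + 3) * (log 2 n * (1 / \<epsilon>))" .
  have "card (float_grid \<delta> L) > 0"
    using zero_in_float_grid[of \<delta> L] finite_float_grid[of \<delta> L] by (auto simp: card_gt_0_iff)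
  then have "log 2 (card (float_grid \<delta> L)) \<le> log 2 ((288 * d + 3) * (log 2 n * (1 / \<epsilon>)))"
    using card by (subst log_le_cancel_iff) auto
  also have "\<dots> = log 2 (288 * d + 3) + (log 2 (log 2 n) + log 2 (1 / \<epsilon>))"
    using logn \<epsilon> by (subst log_mult_pos, simp, simp, subst log_mult_pos) auto
  finally have "log 2 (card (float_grid \<delta> L)) + 1 \<le>
      log 2 (288 * d + 3) + 1 + (log 2 (log 2 n) + log 2 (1 / \<epsilon>))"
    by simp
  moreover have "0 \<le> log 2 (card (float_grid \<delta> L))"
    using \<open>card (float_grid \<delta> L) > 0\<close> by simp
  ultimately have "entry_bits \<le> log 2 (288 * d + 3) + 1 + (log 2 (log 2 n) + log 2 (1 / \<epsilon>))"
    unfolding entry_bits_def by linarith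
  moreover have "0 \<le> log 2 (288 * real d + 3)" by simp
  then have "(log 2 (288 * d + 3) + 1) * 1 \<le>
      (log 2 (288 * d + 3) + 1) * (log 2 (log 2 n) + log 2 (1 / \<epsilon>))"
    using loglog \<epsilon>' by (intro mult_left_mono) auto
  ultimately show ?thesis by (simp add: algebra_simps)
qed

text \<open>Each constant factor 2 is paid for with one power of \<open>n\<close>, and the final
  ceiling with one more \<open>log 2 n\<close>.\<close>

lemma counter_bits_le:
  assumes n: "n \<ge> 2" and W_le: "W \<le> n ^ d" and L_le: "L \<le> real n ^ d"
  shows "counter_bits \<le> (5 * d + 6) * log 2 n"
proof -
  have "max_weight \<le> real n * L ^ 4 + 1"
    unfolding max_weight_def using L by (intro of_nat_nat_ceiling_le) simp
  also have "\<dots> \<le> real n * (real n ^ d) ^ 4 + real n * (real n ^ d) ^ 4"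
  proof (intro add_mono mult_left_mono power_mono L_le)
    have "1 * 1 \<le> real n * (real n ^ d) ^ 4"
      using n by (intro mult_mono one_le_power) auto
    then show "1 \<le> real n * (real n ^ d) ^ 4" by simp
  qed (use L in auto)
  also have "\<dots> \<le> real n * (real n * (real n ^ d) ^ 4)"
    using n mult_right_mono[of 2 "real n" "real n * (real n ^ d) ^ 4"] by simp
  also have "\<dots> = real (n ^ (4 * d + 2))"
    by (simp add: power_add power_mult[symmetric] mult.commute[of d] power2_eq_square)
  finally have weight: "max_weight \<le> n ^ (4 * d + 2)"
    by (simp only: of_nat_le_iff)
  have "max_total \<le> n * n ^ d * n ^ (4 * d + 2)"
    unfolding max_total_def using weight W_le n by (intro mult_mono) auto
  also have "\<dots> = n ^ (1 + d + (4 * d + 2))"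
    by (simp only: power_add power_one_right)
  also have "1 + d + (4 * d + 2) = 5 * d + 3"
    by simp
  finally have total: "max_total \<le> n ^ (5 * d + 3)" .
  have mono: "n ^ i \<le> n ^ (5 * d + 3)" if "i \<le> 5 * d + 3" for i
    using n that by (intro power_increasing) auto
  have "max_total + max_weight + W + 2 \<le> 4 * n ^ (5 * d + 3)"
    using total weight W_le n mono[of "4 * d + 2"] mono[of d] mono[of 1, unfolded power_one_right]
    by linarith
  also have "\<dots> \<le> n\<^sup>2 * n ^ (5 * d + 3)"
    using n power_mono[of 2 n 2] by (intro mult_right_mono) auto
  also have "\<dots> = n ^ (5 * d + 5)"
    by (simp add: algebra_simps flip: power_add)
  finally have "real (max_total + max_weight + W + 2) \<le> real (n ^ (5 * d + 5))"
    by (simp only: of_nat_le_iff)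
  then have "log 2 (real (max_total + max_weight + W + 2)) \<le> log 2 (real (n ^ (5 * d + 5)))"
    using n by (subst log_le_cancel_iff) auto
  also have "\<dots> = (5 * d + 5) * log 2 n"
    using n by (simp add: log_nat_power)
  finally have "log 2 (real (max_total + max_weight + W + 2)) \<le> (5 * d + 5) * log 2 n" .
  moreover have "1 \<le> log 2 n" "0 \<le> log 2 (real (max_total + max_weight + W + 2))"
    using n by simp_all
  ultimately show ?thesis
    unfolding counter_bits_def by (simp add: algebra_simps) linarith
qed

text \<open>The counter width is estimated in two ways: by \<open>c * log 2 n\<close> where it
  counts checkpoints, and by \<open>c * n\<close> where it sits beside the entries of a sampled row.
  So only one logarithmic factor survives.\<close>

lemma memory_bits_le:
  assumes n: "n \<ge> 4" and W_le: "W \<le> n ^ d" and L_le: "L \<le> real n ^ d"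
    and c: "c = 5 * d + 6" "e = log 2 (288 * d + 3) + 2"
  shows "memory_bits \<le> c * (5 + 4 * (2 * c + 49 * (2 * c + e))) *
    (n / \<epsilon>\<^sup>2 * log 2 n * (log 2 (log 2 n) + log 2 (1 / \<epsilon>)))"
proof -
  define l where "l = log 2 (log 2 n) + log 2 (1 / \<epsilon>)"
  define q where "q = real counter_bits"
  define k where "k = 1 / \<epsilon>\<^sup>2"
  define u where "u = real n * l"
  have logn: "log 2 n \<ge> 2"
    using n le_log_iff[of 2 n 2] by simp
  then have "log 2 (log 2 n) \<ge> 1"
    using le_log_iff[of 2 "log 2 n" 1] by simp
  moreover have "log 2 (1 / \<epsilon>) \<ge> 0" using \<epsilon> by simp
  ultimately have l: "l \<ge> 1" by (simp add: l_def)
  have c0: "c \<ge> 0" "e \<ge> 0" using c by simp_all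
  have "1 \<le> counter_bits"
    using counter_bound by (cases counter_bits) auto
  then have q1: "q \<ge> 1" by (simp add: q_def)
  have q: "q \<le> c * log 2 n"
    using counter_bits_le[OF _ W_le L_le] n by (simp add: q_def c)
  have "log 2 n \<le> n"
    using log2_of_power_le[of n n] less_exp[of n] n by simp
  then have "q \<le> c * n"
    using q mult_left_mono[OF \<open>log 2 n \<le> n\<close> c0(1)] by simp
  also have "\<dots> \<le> c * u"
    using c0 l n by (intro mult_left_mono) (auto simp: u_def)
  finally have qu: "q \<le> c * u" .
  have u: "u \<ge> 1"
    using mult_mono[of 1 "real n" 1 l] l n by (simp add: u_def)
  have eps: "1 \<le> k"
    using \<epsilon> by (simp add: k_def power_le_one)
  have "real s \<le> 48 / \<epsilon>\<^sup>2 + 1"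
    unfolding s_def by (rule of_nat_nat_ceiling_le) simp
  also have "\<dots> \<le> 49 * k"
    using eps by (simp add: k_def)
  finally have s_le: "real s \<le> 49 * k" .
  have "real n * entry_bits \<le> e * u"
    using mult_left_mono[OF entry_bits_le[OF n L_le], of "real n"] by (simp add: u_def l_def c ac_simps)
  then have "2 * q + real n * entry_bits \<le> (2 * c + e) * u"
    using qu by (simp add: algebra_simps)
  then have "s * (2 * q + real n * entry_bits) \<le> (49 * k) * ((2 * c + e) * u)"
    using s_le q1 by (intro mult_mono) auto
  moreover have "2 * q \<le> k * (2 * c * u)"
    using qu mult_right_mono[OF eps, of "2 * c * u"] c0 u by simp
  ultimately have inner: "2 * q + s * (2 * q + real n * entry_bits) \<le>
      (2 * c + 49 * (2 * c + e)) * (u * k)"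
    by (simp add: algebra_simps)
  have one: "1 \<le> u * k"
    using mult_mono[OF u eps] u by simp
  have "real memory_bits = q + (2 * q + 2) + (2 * q + 2) * (2 * q + s * (2 * q + real n * entry_bits))"
    by (simp add: memory_bits_def max_checkpoints_def q_def algebra_simps)
  also have "\<dots> \<le> q * 5 + (4 * q) * (2 * q + s * (2 * q + real n * entry_bits))"
    using q1 by (intro add_mono mult_right_mono) auto
  also have "\<dots> = q * (5 * 1 + 4 * (2 * q + s * (2 * q + real n * entry_bits)))"
    by (simp add: algebra_simps)
  also have "\<dots> \<le> (c * log 2 n) * (5 * (u * k) +
      4 * ((2 * c + 49 * (2 * c + e)) * (u * k)))"
    using q q1 inner one c0 logn by (intro mult_mono add_mono) auto
  also have "\<dots> = c * (5 + 4 * (2 * c + 49 * (2 * c + e))) * (n / \<epsilon>\<^sup>2 * log 2 n * l)"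
    by (simp add: u_def k_def algebra_simps add_divide_distrib)
  finally show ?thesis by (simp add: l_def)
qed

end

section \<open>Asymptotics uniform in the accuracy, and assembly\<close>

lemma eventually_le_power:
  fixes f :: "nat \<Rightarrow> real"
  assumes "f \<in> O(\<lambda>n. real n powr p)"
  obtains d where "\<And>d'. d' \<ge> d \<Longrightarrow> \<forall>\<^sub>F n in sequentially. f n \<le> real n ^ d'"
proof -
  obtain C where C: "C > 0" "\<forall>\<^sub>F n in sequentially. norm (f n) \<le> C * norm (real n powr p)"
    using assms by (rule landau_o.bigE)
  \<comment> \<open>Once \<open>n\<close> exceeds \<open>C\<close>, one extra power of
    \<open>n\<close> absorbs the constant. All larger exponents are provided so that
    \<open>W\<close> and \<open>L\<close> can share one.\<close>
  have "\<forall>\<^sub>F n in sequentially. f n \<le> real n ^ d'" if d': "d' \<ge> nat \<lceil>p + 1\<rceil>" for d'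
    using C(2) eventually_ge_at_top[of "nat \<lceil>C\<rceil>"] eventually_ge_at_top[of 1]
  proof eventually_elim
    case (elim n)
    have n: "real n \<ge> 1" "real n \<ge> C" using elim by auto
    have "f n \<le> C * real n powr p"
      using elim(1) n by simp
    also have "\<dots> \<le> real n * real n powr p"
      using n by (intro mult_right_mono) auto
    also have "\<dots> = real n powr (p + 1)"
      using n by (simp add: powr_add)
    also have "\<dots> \<le> real n powr real d'"
      using n d' by (intro powr_mono) linarith+
    also have "\<dots> = real n ^ d'"
      using n by (simp add: powr_realpow)
    finally show ?case .
  qed
  then show thesis by (rule that)
qed

text \<open>For \<open>L < 1\<close> no nonzero magnitude is admissible and all rows vanish, so
  replacing \<open>L\<close> by 1 keeps the stream bounded and lets the sampler assume
  \<open>L \<ge> 1\<close>.\<close>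

lemma bounded_stream_max_one:
  assumes "bounded_stream n L rs"
  shows "bounded_stream n (max 1 L) rs"
proof -
  have "x = 0 \<or> 1 / max 1 L \<le> \<bar>x\<bar> \<and> \<bar>x\<bar> \<le> max 1 L"
    if "x = 0 \<or> 1 / L \<le> \<bar>x\<bar> \<and> \<bar>x\<bar> \<le> L" for x :: real
  proof (cases "L \<ge> 1 \<or> x = 0")
    case True
    then show ?thesis using that by (auto simp: max_def)
  next
    case False
    then have "L > 0" using that by auto
    then have "1 < 1 / L" using False by simp
    then show ?thesis using that False by linarith
  qed
  then show ?thesis using assms by (auto simp: bounded_stream_def)
qed

lemma trivial_algorithm:
  obtains alg where "\<And>b. answer alg b = ([], mat_of_rows n [])"
    "\<And>rs h. h \<in> set_pmf (run alg rs) \<Longrightarrow> peak_space h \<le> 0"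
proof -
  define alg where "alg = \<lparr>initial_state = return_pmf [], process_row = (\<lambda>_ _. return_pmf []),
    answer = (\<lambda>_. ([], mat_of_rows n [] :: real mat))\<rparr>"
  have "peak_space h \<le> 0" if "h \<in> set_pmf (run alg rs)" for rs h
    by (rule peak_space_le[OF _ _ that]) (simp_all add: alg_def)
  moreover have "answer alg b = ([], mat_of_rows n [])" for b
    by (simp add: alg_def)
  ultimately show thesis using that by blast
qed

text \<open>For \<open>\<epsilon> \<ge> 1\<close> the empty matrix is good enough. This case must not use any memory: the claimed
  space bound vanishes at \<open>\<epsilon> = log n\<close>.\<close>

definition space_bound :: "nat \<Rightarrow> nat \<Rightarrow> real \<Rightarrow> real \<Rightarrow> nat" where
  "space_bound n W L \<epsilon> = (if \<epsilon> < 1 \<and> W > 0 then row_sampler.memory_bits n W L \<epsilon> else 0)"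

lemma sliding_window_algorithm:
  assumes "\<epsilon> > 0"
  obtains alg where
    "\<And>rs. bounded_stream n L rs \<Longrightarrow> measure_pmf.prob (run alg rs)
       {h. covariance_approximation \<epsilon> (window n W rs) (answer alg (hd h))} \<ge> 2 / 3"
    "\<And>rs h. h \<in> set_pmf (run alg rs) \<Longrightarrow> peak_space h \<le> space_bound n W (max 1 L) \<epsilon>"
proof (cases "\<epsilon> < 1 \<and> W > 0")
  case True
  then interpret row_sampler n W "max 1 L" \<epsilon>
    using assms by unfold_locales auto
  obtain alg where "\<And>rs. bounded_stream n (max 1 L) rs \<Longrightarrow> measure_pmf.prob (run alg rs)
       {h. covariance_approximation \<epsilon> (window n W rs) (answer alg (hd h))} \<ge> 2 / 3"
    "\<And>rs h. h \<in> set_pmf (run alg rs) \<Longrightarrow> peak_space h \<le> memory_bits"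
    using row_sampling_algorithm by blast
  then show thesis
    using True by (intro that[of alg]) (auto simp: space_bound_def bounded_stream_max_one)
next
  case False
  obtain alg where alg: "\<And>b. answer alg b = ([], mat_of_rows n [])"
    "\<And>rs h. h \<in> set_pmf (run alg rs) \<Longrightarrow> peak_space h \<le> 0"
    using trivial_algorithm by blast
  have "covariance_approximation \<epsilon> (window n W rs) (answer alg b)" for rs b
    using False empty_answer[OF assms, of "drop (length rs - W) rs" n]
    by (auto simp: alg window_def)
  then show thesis
    using alg by (intro that[of alg]) (auto simp: space_bound_def)
qed

lemma space_bound_bigo:
  assumes W: "(\<lambda>n. real (W n)) \<in> O(\<lambda>n. real n powr p)" and L: "L \<in> O(\<lambda>n. real n powr q)"
  shows "(\<lambda>(n, \<epsilon>). real (space_bound n (W n) (max 1 (L n)) \<epsilon>)) \<in> O[at_top \<times>\<^sub>F principal {0<..}](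
    \<lambda>(n, \<epsilon>). real n / \<epsilon>\<^sup>2 * log 2 (real n) * (log 2 (log 2 (real n)) + log 2 (1 / \<epsilon>)))"
proof -
  obtain d1 d2 where
    d1: "\<And>d. d \<ge> d1 \<Longrightarrow> \<forall>\<^sub>F n in sequentially. real (W n) \<le> real n ^ d" and
    d2: "\<And>d. d \<ge> d2 \<Longrightarrow> \<forall>\<^sub>F n in sequentially. L n \<le> real n ^ d"
    using eventually_le_power[OF W] eventually_le_power[OF L] by metis
  define d where "d = max d1 d2"
  define c e where "c = real (5 * d + 6)" and "e = log 2 (288 * d + 3) + 2"
  define C where "C = c * (5 + 4 * (2 * c + 49 * (2 * c + e)))"
  define B where "B = (\<lambda>(n, \<epsilon>).
    real n / \<epsilon>\<^sup>2 * log 2 (real n) * (log 2 (log 2 (real n)) + log 2 (1 / \<epsilon>)))"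
  have C: "C \<ge> 0"
    unfolding C_def by (intro mult_nonneg_nonneg add_nonneg_nonneg) (auto simp: c_def e_def)
  have ev: "\<forall>\<^sub>F n in sequentially. n \<ge> 4 \<and> W n \<le> n ^ d \<and> max 1 (L n) \<le> real n ^ d"
    using d1[of d, unfolded d_def, OF max.cobounded1] d2[of d, unfolded d_def, OF max.cobounded2]
      eventually_ge_at_top[of 4]
  proof eventually_elim
    case (elim n)
    have "real (W n) \<le> real (n ^ d)" "1 \<le> real n ^ d"
      using elim by (auto intro: one_le_power simp: d_def)
    then show ?case
      using elim by (simp add: d_def del: of_nat_power)
  qed
  \<comment> \<open>The absolute value matters: for \<open>\<epsilon> > log 2 n\<close> the claimed
    bound is negative, while the space is 0.\<close>
  have "real (space_bound n (W n) (max 1 (L n)) \<epsilon>) \<le> C * \<bar>B (n, \<epsilon>)\<bar>"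
    if n: "n \<ge> 4 \<and> W n \<le> n ^ d \<and> max 1 (L n) \<le> real n ^ d" and \<epsilon>: "\<epsilon> > 0" for n \<epsilon>
  proof (cases "\<epsilon> < 1 \<and> W n > 0")
    case True
    then interpret row_sampler n "W n" "max 1 (L n)" \<epsilon>
      using \<epsilon> by unfold_locales auto
    have "real memory_bits \<le> C * B (n, \<epsilon>)"
      using memory_bits_le[of d c e] n by (simp add: C_def B_def c_def e_def)
    also have "\<dots> \<le> C * \<bar>B (n, \<epsilon>)\<bar>"
      using C by (intro mult_left_mono) auto
    finally show ?thesis using True by (simp add: space_bound_def)
  next
    case False
    then have "space_bound n (W n) (max 1 (L n)) \<epsilon> = 0"
      by (simp only: space_bound_def if_False)
    then show ?thesis using C by simp
  qed
  \<comment> \<open>The threshold for \<open>n\<close> comes from \<open>ev\<close> and is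
    independent of \<open>\<epsilon>\<close>, as the product with the principal filter
    demands.\<close>
  then have "\<forall>\<^sub>F x in at_top \<times>\<^sub>F principal {0<..}.
      norm (case x of (n, \<epsilon>) \<Rightarrow> real (space_bound n (W n) (max 1 (L n)) \<epsilon>)) \<le> C * norm (B x)"
    unfolding eventually_prod_filter eventually_principal
    using ev by (intro exI conjI[rotated]; assumption?) auto
  then show ?thesis
    unfolding B_def by (rule bigoI)
qed

theorem mainTheorem10:
  fixes p q :: real and W :: "nat \<Rightarrow> nat" and L :: "nat \<Rightarrow> real"
  assumes "p > 0"
    and "(\<lambda>n. real (W n)) \<in> O(\<lambda>n. real n powr p)"
    and "L \<in> O(\<lambda>n. real n powr q)"
  shows "\<exists>alg :: nat \<Rightarrow> real \<Rightarrow> stream_algorithm.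
    (\<forall>n \<epsilon> rs. n \<ge> 1 \<longrightarrow> \<epsilon> > 0 \<longrightarrow> bounded_stream n (L n) rs \<longrightarrow>
       measure_pmf.prob (run (alg n \<epsilon>) rs)
         {h. covariance_approximation \<epsilon> (window n (W n) rs) (answer (alg n \<epsilon>) (hd h))} \<ge> 2 / 3) \<and>
    (\<forall>k>0. \<exists>space :: nat \<Rightarrow> real \<Rightarrow> real.
       (\<lambda>(n, \<epsilon>). space n \<epsilon>) \<in> O[at_top \<times>\<^sub>F principal {0<..}](
         \<lambda>(n, \<epsilon>). real n / \<epsilon>\<^sup>2 * log 2 (real n) * (log 2 (log 2 (real n)) + log 2 (1 / \<epsilon>))) \<and>
       (\<forall>n \<epsilon> rs. n \<ge> 1 \<longrightarrow> \<epsilon> > 0 \<longrightarrow> bounded_stream n (L n) rs \<longrightarrow>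
          measure_pmf.prob (run (alg n \<epsilon>) rs) {h. real (peak_space h) \<le> space n \<epsilon>}
            \<ge> 1 - real n powr (- k)))"
proof -
  define good where "good n \<epsilon> alg \<longleftrightarrow>
    (\<forall>rs. bounded_stream n (L n) rs \<longrightarrow> measure_pmf.prob (run alg rs)
       {h. covariance_approximation \<epsilon> (window n (W n) rs) (answer alg (hd h))} \<ge> 2 / 3) \<and>
    (\<forall>rs. \<forall>h \<in> set_pmf (run alg rs). peak_space h \<le> space_bound n (W n) (max 1 (L n)) \<epsilon>)"
    for n \<epsilon> alg
  have "\<exists>alg. good n \<epsilon> alg" if "\<epsilon> > 0" for n \<epsilon>
    using sliding_window_algorithm[OF that, of n "L n" "W n"] unfolding good_def by metis
  then have "\<forall>n \<epsilon>. \<exists>alg. \<epsilon> > 0 \<longrightarrow> good n \<epsilon> alg" by blast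
  then obtain alg where alg: "\<And>n \<epsilon>. \<epsilon> > 0 \<Longrightarrow> good n \<epsilon> (alg n \<epsilon>)"
    unfolding choice_iff by blast
  \<comment> \<open>The probability is 1, so the same space function serves every
    \<open>k\<close>.\<close>
  have "measure_pmf.prob (run (alg n \<epsilon>) rs)
      {h. real (peak_space h) \<le> real (space_bound n (W n) (max 1 (L n)) \<epsilon>)} \<ge> 1 - real n powr (- k)"
    if "\<epsilon> > 0" for n \<epsilon> rs k
  proof -
    have "AE h in run (alg n \<epsilon>) rs.
        h \<in> {h. real (peak_space h) \<le> real (space_bound n (W n) (max 1 (L n)) \<epsilon>)}"
      using alg[OF that] by (simp add: good_def AE_measure_pmf_iff)
    then have "measure_pmf.prob (run (alg n \<epsilon>) rs)
        {h. real (peak_space h) \<le> real (space_bound n (W n) (max 1 (L n)) \<epsilon>)} = 1"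
      by (subst measure_pmf.prob_eq_1) auto
    then show ?thesis by simp
  qed
  moreover note space_bound_bigo[OF assms(2,3)]
  moreover have "measure_pmf.prob (run (alg n \<epsilon>) rs)
      {h. covariance_approximation \<epsilon> (window n (W n) rs) (answer (alg n \<epsilon>) (hd h))} \<ge> 2 / 3"
    if "\<epsilon> > 0" "bounded_stream n (L n) rs" for n \<epsilon> rs
    using alg[OF that(1)] that(2) by (simp add: good_def)
  ultimately show ?thesis
    by (intro exI[of _ alg] conjI allI impI
        exI[of _ "\<lambda>n \<epsilon>. real (space_bound n (W n) (max 1 (L n)) \<epsilon>)"]) auto
qed

end
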